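(* Let $n\ge 3$. Every $G\in \mathrm{SU}(2^n)$ can be factored as $$G=(K^{(0)}\otimes I)\, e^{f^{(0)}}\,(K^{(1)}\otimes I)\,(I^{\otimes (n-1)}\otimes\widetilde{K}^{(0)})\, e^{h^{(0)}}\,(K^{(2)}\otimes I)\, e^{f^{(1)}}\,(K^{(3)}\otimes I)\,(I^{\otimes (n-1)}\otimes\widetilde{K}^{(1)})$$ for some $K^{(0)},K^{(1)},K^{(2)},K^{(3)}\in \mathrm{SU}(2^{n-1})$, $\widetilde{K}^{(0)},\widetilde{K}^{(1)}\in \mathrm{SU}(2)$, $h^{(0)}\in \mathfrak{h}_n$ and $f^{(0)},f^{(1)}\in \mathfrak{f}_n$.
   Context: $I$ is the $2\times2$ identity matrix, $\otimes$ is the Kronecker product, $I^{\otimes k}$ is the $k$-fold Kronecker power ($I^{\otimes 0}=1$), and for a set $S$ of matrices and a matrix $A$, $S\otimes A:=\{s\otimes A: s\in S\}$. The Pauli matrices are $$X=\begin{pmatrix}0&1\\1&0\end{pmatrix},\quad Y=\begin{pmatrix}0&-i\\i&0\end{pmatrix},\quad Z=\begin{pmatrix}1&0\\0&-1\end{pmatrix}.$$ Define recursively sets of skew-Hermitian matrices $\mathcal{H}_n\subset\mathfrak{su}(2^n)$: $\mathcal{H}_2:=\{\tfrac i2 X\otimes X,\ \tfrac i2 Y\otimes Y,\ \tfrac i2 Z\otimes Z\}$ and, for $n\ge3$, $$\overline{\mathcal{H}}_n:=\bigcup_{j=2}^{n-1}\bigl(\mathcal{H}_j\otimes I^{\otimes(n-1-j)}\bigr),\qquad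 \mathcal{H}_n:=\Bigl\{\tfrac i2 I^{\otimes(n-1)}\otimes X\Bigr\}\cup\bigl(\overline{\mathcal{H}}_n\otimes X\bigr),\qquad \mathcal{F}_n:=\overline{\mathcal{H}}_n\otimes Z .$$ Then $\mathfrak{h}_n:=\mathrm{span}_{\mathbb{R}}(\mathcal{H}_n)$ and $\mathfrak{f}_n:=\mathrm{span}_{\mathbb{R}}(\mathcal{F}_n)$, both subspaces of $\mathfrak{su}(2^n)$. *)

theory Defs
  imports Complex_Main "Jordan_Normal_Form.Determinant" "Jordan_Normal_Form.Schur_Decomposition"
begin

definition kron :: "complex mat \<Rightarrow> complex mat \<Rightarrow> complex mat" (infixl \<open>\<otimes>\<^sub>K\<close> 75) where
  "A \<otimes>\<^sub>K B = mat (dim_row A * dim_row B) (dim_col A * dim_col B)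
     (\<lambda>(i, j). A $$ (i div dim_row B, j div dim_col B) * B $$ (i mod dim_row B, j mod dim_col B))"

lemma kron_carrier [simp]:
  "A \<in> carrier_mat a b \<Longrightarrow> B \<in> carrier_mat c d \<Longrightarrow> A \<otimes>\<^sub>K B \<in> carrier_mat (a * c) (b * d)"
  unfolding kron_def by auto

fun kron_pow :: "complex mat \<Rightarrow> nat \<Rightarrow> complex mat" where
  "kron_pow A 0 = 1\<^sub>m 1"
| "kron_pow A (Suc k) = kron_pow A k \<otimes>\<^sub>K A"

lemma kron_pow_carrier [simp]:
  "A \<in> carrier_mat a b \<Longrightarrow> kron_pow A k \<in> carrier_mat (a ^ k) (b ^ k)"
proof (induction k)
  case (Suc k)
  then show ?case using kron_carrier[of "kron_pow A k" "a ^ k" "b ^ k" A a b]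
    by (simp add: mult.commute)
qed simp

definition kron_right :: "complex mat set \<Rightarrow> complex mat \<Rightarrow> complex mat set" where
  "kron_right S A = (\<lambda>s. s \<otimes>\<^sub>K A) ` S"

abbreviation Id2 :: "complex mat" where "Id2 \<equiv> 1\<^sub>m 2"

definition pauli_X :: "complex mat" where
  "pauli_X = mat_of_rows_list 2 [[0, 1], [1, 0]]"

definition pauli_Y :: "complex mat" where
  "pauli_Y = mat_of_rows_list 2 [[0, - \<i>], [\<i>, 0]]"

definition pauli_Z :: "complex mat" where
  "pauli_Z = mat_of_rows_list 2 [[1, 0], [0, - 1]]"

lemma pauli_carrier [simp]:
  "pauli_X \<in> carrier_mat 2 2" "pauli_Y \<in> carrier_mat 2 2" "pauli_Z \<in> carrier_mat 2 2"
  unfolding pauli_X_def pauli_Y_def pauli_Z_def by (auto simp: mat_of_rows_list_def)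

definition SU :: "nat \<Rightarrow> complex mat set" where
  "SU d = {U \<in> carrier_mat d d. mat_adjoint U * U = 1\<^sub>m d \<and> det U = 1}"

text \<open>The exponential of a square matrix, as the entrywise sum of the power series; the series
  converges by \<open>mat_exp_summable\<close> below.\<close>

definition mat_exp :: "complex mat \<Rightarrow> complex mat" where
  "mat_exp A = mat (dim_row A) (dim_row A) (\<lambda>(i, j). \<Sum>k. (A ^\<^sub>m k) $$ (i, j) / fact k)"

lemma mat_exp_summable:
  fixes A :: "complex mat"
  assumes A: "A \<in> carrier_mat d d" and i: "i < d" and j: "j < d"
  shows "summable (\<lambda>k. (A ^\<^sub>m k) $$ (i, j) / fact k)"
proof -
  define B where "B = (\<Sum>p\<in>{..<d} \<times> {..<d}. cmod (A $$ p))"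
  have B: "cmod (A $$ (p, q)) \<le> B" if "p < d" "q < d" for p q
    unfolding B_def using that by (intro member_le_sum) auto
  have B0: "0 \<le> B" unfolding B_def by (intro sum_nonneg) auto
  have bound: "\<forall>p<d. \<forall>q<d. cmod ((A ^\<^sub>m k) $$ (p, q)) \<le> (real d * B) ^ k" for k
  proof (induction k)
    case 0
    then show ?case using A by (auto simp: one_mat_def)
  next
    case (Suc k)
    show ?case
    proof (intro allI impI)
      fix p q assume p: "p < d" and q: "q < d"
      have Ak: "A ^\<^sub>m k \<in> carrier_mat d d" using A by simp
      have "(A ^\<^sub>m Suc k) $$ (p, q) = (\<Sum>l<d. (A ^\<^sub>m k) $$ (p, l) * A $$ (l, q))"
        using A Ak p q by (simp add: scalar_prod_def atLeast0LessThan)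
      also have "cmod \<dots> \<le> (\<Sum>l<d. (real d * B) ^ k * B)"
        using Suc p q B B0 by (intro sum_norm_le) (auto simp: norm_mult intro!: mult_mono)
      also have "\<dots> = (real d * B) ^ Suc k" by simp
      finally show "cmod ((A ^\<^sub>m Suc k) $$ (p, q)) \<le> (real d * B) ^ Suc k" .
    qed
  qed
  show ?thesis
  proof (rule summable_comparison_test)
    show "\<exists>N. \<forall>k\<ge>N. norm ((A ^\<^sub>m k) $$ (i, j) / fact k) \<le> inverse (fact k) * (real d * B) ^ k"
    proof (intro exI allI impI)
      fix k
      have "cmod ((A ^\<^sub>m k) $$ (i, j)) \<le> (real d * B) ^ k" using bound i j by blast
      then show "norm ((A ^\<^sub>m k) $$ (i, j) / fact k) \<le> inverse (fact k) * (real d * B) ^ k"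
        by (simp add: norm_divide field_simps)
    qed
    show "summable (\<lambda>k. inverse (fact k) * (real d * B) ^ k)" by (rule summable_exp)
  qed
qed

text \<open>The real span, inside the \<open>d \<times> d\<close> complex matrices: finite linear combinations with
  real coefficients, where the empty combination is the zero matrix.\<close>

definition real_span :: "nat \<Rightarrow> complex mat set \<Rightarrow> complex mat set" where
  "real_span d S = {mat d d (\<lambda>(i, j). \<Sum>A\<in>T. complex_of_real (c A) * A $$ (i, j)) | T c.
     finite T \<and> T \<subseteq> S}"

text \<open>\<open>calH n\<close> is only meaningful for \<open>n \<ge> 2\<close>, and \<open>barH n\<close> and \<open>calF n\<close> for \<open>n \<ge> 3\<close>.
  In the recursive equation \<open>barH n\<close> has to be written out.\<close>

function calH :: "nat \<Rightarrow> complex mat set" where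
  "calH n =
     (if n < 2 then {}
      else if n = 2 then
        {(\<i> / 2) \<cdot>\<^sub>m (pauli_X \<otimes>\<^sub>K pauli_X), (\<i> / 2) \<cdot>\<^sub>m (pauli_Y \<otimes>\<^sub>K pauli_Y),
         (\<i> / 2) \<cdot>\<^sub>m (pauli_Z \<otimes>\<^sub>K pauli_Z)}
      else {(\<i> / 2) \<cdot>\<^sub>m (kron_pow Id2 (n - 1) \<otimes>\<^sub>K pauli_X)} \<union>
        kron_right (\<Union>j\<in>{2..n - 1}. kron_right (calH j) (kron_pow Id2 (n - 1 - j))) pauli_X)"
  by pat_completeness auto
termination by (relation "measure id") auto

declare calH.simps [simp del]

definition barH :: "nat \<Rightarrow> complex mat set" where
  "barH n = (\<Union>j\<in>{2..n - 1}. kron_right (calH j) (kron_pow Id2 (n - 1 - j)))"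

lemma calH_2:
  "calH 2 = {(\<i> / 2) \<cdot>\<^sub>m (pauli_X \<otimes>\<^sub>K pauli_X), (\<i> / 2) \<cdot>\<^sub>m (pauli_Y \<otimes>\<^sub>K pauli_Y),
     (\<i> / 2) \<cdot>\<^sub>m (pauli_Z \<otimes>\<^sub>K pauli_Z)}"
  by (subst calH.simps) simp

lemma calH_rec:
  "n \<ge> 3 \<Longrightarrow> calH n = {(\<i> / 2) \<cdot>\<^sub>m (kron_pow Id2 (n - 1) \<otimes>\<^sub>K pauli_X)} \<union> kron_right (barH n) pauli_X"
  by (subst calH.simps) (simp add: barH_def)

definition calF :: "nat \<Rightarrow> complex mat set" where
  "calF n = kron_right (barH n) pauli_Z"

definition frak_h :: "nat \<Rightarrow> complex mat set" where
  "frak_h n = real_span (2 ^ n) (calH n)"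

definition frak_f :: "nat \<Rightarrow> complex mat set" where
  "frak_f n = real_span (2 ^ n) (calF n)"

text \<open>All generators are \<open>2 ^ n \<times> 2 ^ n\<close> matrices, so \<open>real_span\<close> only reads entries
  that exist.\<close>

lemma calH_carrier: "n \<ge> 2 \<Longrightarrow> calH n \<subseteq> carrier_mat (2 ^ n) (2 ^ n)"
proof (induction n rule: less_induct)
  case (less n)
  have pw: "(2::nat) ^ (n - 1) * 2 = 2 ^ n" using less.prems by (cases n) auto
  have kp: "kron_pow Id2 k \<in> carrier_mat (2 ^ k) (2 ^ k)" for k
    by (rule kron_pow_carrier) simp
  show ?case
  proof (cases "n = 2")
    case True
    have "A \<otimes>\<^sub>K B \<in> carrier_mat (2 ^ 2) (2 ^ 2)"
      if "A \<in> carrier_mat 2 2" "B \<in> carrier_mat 2 2" for A B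
      using kron_carrier[OF that] by simp
    then show ?thesis using True by (auto simp: calH_2)
  next
    case False
    with less.prems have n: "n \<ge> 3" by simp
    have bar: "M \<in> carrier_mat (2 ^ (n - 1)) (2 ^ (n - 1))" if "M \<in> barH n" for M
    proof -
      from that obtain j s where j: "2 \<le> j" "j \<le> n - 1" and s: "s \<in> calH j"
        and M: "M = s \<otimes>\<^sub>K kron_pow Id2 (n - 1 - j)"
        unfolding barH_def kron_right_def by auto
      have "j < n" using j n by linarith
      then have "s \<in> carrier_mat (2 ^ j) (2 ^ j)" using less.IH[of j] j s by auto
      from kron_carrier[OF this kp[of "n - 1 - j"]] show ?thesis
        unfolding M using j by (simp add: power_add[symmetric] del: kron_carrier)
    qed
    have X: "A \<otimes>\<^sub>K pauli_X \<in> carrier_mat (2 ^ n) (2 ^ n)"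
      if "A \<in> carrier_mat (2 ^ (n - 1)) (2 ^ (n - 1))" for A
      using kron_carrier[OF that pauli_carrier(1)] by (simp only: pw)
    show ?thesis
      unfolding calH_rec[OF n] kron_right_def using X[OF kp] X[OF bar] by auto
  qed
qed

lemma calF_carrier:
  assumes "n \<ge> 3" shows "calF n \<subseteq> carrier_mat (2 ^ n) (2 ^ n)"
proof
  fix M assume "M \<in> calF n"
  then obtain j s where j: "2 \<le> j" "j \<le> n - 1" and s: "s \<in> calH j"
    and M: "M = s \<otimes>\<^sub>K kron_pow Id2 (n - 1 - j) \<otimes>\<^sub>K pauli_Z"
    unfolding calF_def barH_def kron_right_def by auto
  have "s \<in> carrier_mat (2 ^ j) (2 ^ j)" using calH_carrier[of j] j s by auto
  from kron_carrier[OF kron_carrier[OF this kron_pow_carrier[of Id2 2 2 "n - 1 - j"]] pauli_carrier(3)]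
  have "M \<in> carrier_mat (2 ^ (n - 1) * 2) (2 ^ (n - 1) * 2)"
    using j by (simp add: M power_add[symmetric])
  moreover have "(2::nat) ^ (n - 1) * 2 = 2 ^ n" using assms by (cases n) auto
  ultimately show "M \<in> carrier_mat (2 ^ n) (2 ^ n)" by simp
qed

end

theory Submission
  imports Defs "HOL-Computational_Algebra.Fundamental_Theorem_Algebra"
begin

text \<open>
  Split matrices into \<open>2 \<times> 2\<close> blocks with respect to the last tensor factor. The cosine-sine
  decomposition writes \<open>G\<close> as a product of a block diagonal unitary matrix, a matrix whose blocks
  are \<open>cos \<Theta>\<close> and \<open>i sin \<Theta>\<close> for a real diagonal \<open>\<Theta>\<close>, and a second block diagonal unitary matrix.
  A block diagonal matrix \<open>diag(A, B)\<close> with \<open>det A det B = 1\<close> factors further: after a relative phase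
  is moved into \<open>I \<otimes> K\<close>, the spectral theorem gives \<open>A B* = U D\<^sup>2 U*\<close> with \<open>D\<close> diagonal of
  determinant \<open>1\<close>, and \<open>A = U D V\<close>, \<open>B = U D* V\<close> with \<open>V = D U* B\<close>.

  The generators in \<open>barH n\<close> have a common orthonormal eigenbasis, the columns of \<open>W\<close>: the Bell basis
  for \<open>n = 3\<close>, tensored with the eigenbasis of \<open>X\<close> at each further step. Together with \<open>i I\<close>
  they span all matrices \<open>i W \<Theta> W*\<close> with \<open>\<Theta>\<close> real diagonal, where the coefficient of \<open>i I\<close> is the
  mean of \<open>\<Theta>\<close>. Conjugating by \<open>W \<otimes> I\<close> therefore turns the two kinds of diagonal
  factors above into exponentials of elements of \<open>frak_h n\<close> and \<open>frak_f n\<close>.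
\<close>

section \<open>Adjoints and unitary matrices\<close>

lemma mult_mat_index:
  assumes "A \<in> carrier_mat a n" "B \<in> carrier_mat n b" "i < a" "j < b"
  shows "(A * B) $$ (i, j) = (\<Sum>k<n. A $$ (i, k) * B $$ (k, j))"
  using assms by (auto simp: scalar_prod_def atLeast0LessThan)

lemma adjoint_carrier [simp]:
  "A \<in> carrier_mat a b \<Longrightarrow> mat_adjoint A \<in> carrier_mat b a"
  unfolding mat_adjoint_def by (auto simp: mat_of_rows_def)

lemma adjoint_dim [simp]:
  "dim_row (mat_adjoint A) = dim_col A" "dim_col (mat_adjoint A) = dim_row A"
  unfolding mat_adjoint_def by (auto simp: mat_of_rows_def)

lemma adjoint_index [simp]:
  fixes A :: "complex mat"
  assumes "i < dim_col A" "j < dim_row A"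
  shows "mat_adjoint A $$ (i, j) = cnj (A $$ (j, i))"
  using assms unfolding mat_adjoint_def by (auto simp: mat_of_rows_def)

lemma adjoint_adjoint [simp]: "mat_adjoint (mat_adjoint A) = (A :: complex mat)"
  by (rule eq_matI) auto

lemma adjoint_mult:
  fixes A B :: "complex mat"
  assumes "A \<in> carrier_mat a n" "B \<in> carrier_mat n b"
  shows "mat_adjoint (A * B) = mat_adjoint B * mat_adjoint A"
  by (rule eq_matI) (use assms in \<open>auto simp: scalar_prod_def mult.commute intro!: sum.cong\<close>)

lemma adjoint_one [simp]: "mat_adjoint (1\<^sub>m n :: complex mat) = 1\<^sub>m n"
  by (rule eq_matI) auto

lemma adjoint_mat_diag [simp]: "mat_adjoint (mat_diag n d) = mat_diag n (\<lambda>i. cnj (d i))"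
  by (rule eq_matI) (auto simp: mat_diag_def)

lemma mat_diag_index [simp]:
  "i < n \<Longrightarrow> j < n \<Longrightarrow> mat_diag n d $$ (i, j) = (if i = j then d j else 0)"
  by (simp add: mat_diag_def)

lemma mat_diag_dims [simp]: "dim_row (mat_diag n d) = n" "dim_col (mat_diag n d) = n"
  by (simp_all add: mat_diag_def)

lemma mat_diag_cong:
  "(\<And>i. i < n \<Longrightarrow> f i = g i) \<Longrightarrow> mat_diag n f = mat_diag n g"
  by (auto simp: mat_diag_def intro!: eq_matI)

text \<open>Transposing leaves the determinant unchanged, and conjugating all entries conjugates
  every term of the Leibniz sum.\<close>

lemma det_adjoint:
  fixes A :: "complex mat"
  assumes A: "A \<in> carrier_mat n n"
  shows "det (mat_adjoint A) = cnj (det A)"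
proof -
  have "det (mat_adjoint A) = det (transpose_mat (mat_adjoint A))"
    using A by (metis adjoint_carrier det_transpose)
  also have "\<dots> = (\<Sum>p | p permutes {0..<n}. signof p * (\<Prod>i = 0..<n. cnj (A $$ (i, p i))))"
    using A by (subst det_def'[of _ n]) (auto intro!: sum.cong prod.cong simp: permutes_in_image)
  also have "\<dots> = cnj (det A)"
    using A by (subst det_def'[OF A]) (auto simp: sign_def intro!: sum.cong)
  finally show ?thesis .
qed

lemma det_mat_diag: "det (mat_diag n d) = (\<Prod>i<n. d i)" for d :: "nat \<Rightarrow> complex"
  by (subst det_upper_triangular[of _ n])
    (auto simp: prod_list_diag_prod atLeast0LessThan intro!: prod.cong)

definition unitary_mat :: "nat \<Rightarrow> complex mat \<Rightarrow> bool" where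
  "unitary_mat n U \<longleftrightarrow> U \<in> carrier_mat n n \<and> mat_adjoint U * U = 1\<^sub>m n"

lemma SU_iff: "U \<in> SU n \<longleftrightarrow> unitary_mat n U \<and> det U = 1"
  by (auto simp: SU_def unitary_mat_def)

lemma unitary_carrier: "unitary_mat n U \<Longrightarrow> U \<in> carrier_mat n n"
  by (simp add: unitary_mat_def)

lemma unitary_left: "unitary_mat n U \<Longrightarrow> mat_adjoint U * U = 1\<^sub>m n"
  by (simp add: unitary_mat_def)

lemma unitary_right: "unitary_mat n U \<Longrightarrow> U * mat_adjoint U = 1\<^sub>m n"
  unfolding unitary_mat_def using mat_mult_left_right_inverse[of "mat_adjoint U" n U] by auto

text \<open>Once products are nested to the right, this rule and its mirror image let simplification
  cancel an adjoint pair in the middle of a long product.\<close>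

lemma unitary_left_cancel:
  assumes "unitary_mat n U" "dim_row X = n"
  shows "mat_adjoint U * (U * X) = X"
proof -
  have X: "X \<in> carrier_mat n (dim_col X)" and U: "U \<in> carrier_mat n n"
    using assms by (auto simp: unitary_mat_def)
  show ?thesis
    using unitary_left[OF assms(1)] left_mult_one_mat[OF X]
      assoc_mult_mat[OF adjoint_carrier[OF U] U X] by simp
qed

lemma unitary_right_cancel:
  assumes "unitary_mat n U" "dim_row X = n"
  shows "U * (mat_adjoint U * X) = X"
proof -
  have X: "X \<in> carrier_mat n (dim_col X)" and U: "U \<in> carrier_mat n n"
    using assms by (auto simp: unitary_mat_def)
  show ?thesis
    using unitary_right[OF assms(1)] left_mult_one_mat[OF X]
      assoc_mult_mat[OF U adjoint_carrier[OF U] X] by simp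
qed

lemma unitary_one [simp]: "unitary_mat n (1\<^sub>m n)"
  by (simp add: unitary_mat_def)

lemma unitary_adjoint: "unitary_mat n U \<Longrightarrow> unitary_mat n (mat_adjoint U)"
  using unitary_right[of n U] by (simp add: unitary_mat_def)

lemma unitary_mult:
  assumes "unitary_mat n U" "unitary_mat n V"
  shows "unitary_mat n (U * V)"
  using assms unitary_left_cancel[OF assms(1), of V] unitary_left[OF assms(2)]
  by (simp add: unitary_mat_def adjoint_mult[of _ n n _ n] assoc_mult_mat[of _ n n _ n _ n]
      mult_carrier_mat[of _ n n _ n])

lemma unitary_mat_diag:
  assumes "\<And>i. i < n \<Longrightarrow> cmod (d i) = 1"
  shows "unitary_mat n (mat_diag n d)"
proof -
  have "cnj (d i) * d i = 1" if "i < n" for i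
    using assms[OF that] by (metis complex_norm_square mult.commute of_real_1 power_one)
  then show ?thesis
    by (auto simp: unitary_mat_def intro!: eq_matI)
qed

lemma adjoint_smult:
  "mat_adjoint (c \<cdot>\<^sub>m A) = cnj c \<cdot>\<^sub>m mat_adjoint A" for A :: "complex mat"
  by (rule eq_matI) auto

lemma unitary_smult:
  assumes "unitary_mat n U" "cmod c = 1"
  shows "unitary_mat n (c \<cdot>\<^sub>m U)"
proof -
  have "cnj c * c = 1"
    using assms(2) by (metis complex_norm_square mult.commute of_real_1 power_one)
  moreover have "mat_adjoint (c \<cdot>\<^sub>m U) * (c \<cdot>\<^sub>m U) = (cnj c * c) \<cdot>\<^sub>m (mat_adjoint U * U)"
    using assms(1) unfolding unitary_mat_def adjoint_smult
    by (simp add: mult_smult_distrib[of _ n n _ n] mult_smult_assoc_mat[of _ n n _ n])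
      (auto intro!: eq_matI)
  ultimately show ?thesis
    using assms(1) by (auto simp: unitary_mat_def)
qed

lemma cmod_det_unitary:
  assumes "unitary_mat n U"
  shows "cmod (det U) = 1"
proof -
  have "cnj (det U) * det U = 1"
    using det_mult[of "mat_adjoint U" n U] assms
    by (simp add: unitary_mat_def det_adjoint)
  then have "(cmod (det U))\<^sup>2 = 1"
    by (metis complex_norm_square mult.commute of_real_eq_1_iff)
  then show ?thesis
    by (simp add: power2_eq_1_iff) (metis norm_ge_zero neg_0_le_iff_le not_one_le_zero)
qed

section \<open>The spectral theorem for normal matrices\<close>

lemma gram_index:
  fixes M :: "complex mat"
  assumes "M \<in> carrier_mat m n" "i < n" "j < n"
  shows "(mat_adjoint M * M) $$ (i, j) = (\<Sum>k<m. cnj (M $$ (k, i)) * M $$ (k, j))"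
  using assms by (subst mult_mat_index[of _ n m _ n]) (auto intro!: sum.cong)

text \<open>Vanishing columns are replaced one at a time by a unit vector orthogonal to the range.\<close>

lemma orthogonal_columns_unitary:
  assumes "M \<in> carrier_mat n n"
    and "mat_adjoint M * M = mat_diag n (\<lambda>i. complex_of_real ((d i)\<^sup>2))"
  shows "\<exists>U. unitary_mat n U \<and> M = U * mat_diag n (\<lambda>i. complex_of_real (d i))"
  using assms
proof (induction "card {i. i < n \<and> d i = 0}" arbitrary: M d)
  case 0
  then have d0: "\<And>i. i < n \<Longrightarrow> d i \<noteq> 0" by auto
  note M = 0(2)
  \<comment> \<open>Without vanishing columns, dividing column \<open>i\<close> by
    \<open>d i\<close> makes the columns orthonormal. The sign of \<open>d i\<close> is free, since
    the Gram matrix only sees its square.\<close>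
  let ?D = "mat_diag n (\<lambda>i. complex_of_real (1 / d i))"
  have "mat_adjoint (M * ?D) * (M * ?D) = ?D * ((mat_adjoint M * M) * ?D)"
    using M by (simp add: adjoint_mult[of _ n n _ n] assoc_mult_mat[of _ n n _ n _ n]
        mult_carrier_mat[of _ n n _ n])
  also have "\<dots> = 1\<^sub>m n"
    unfolding 0(3) using d0 by (auto intro!: eq_matI simp: power2_eq_square)
  finally have "unitary_mat n (M * ?D)"
    using M by (simp add: unitary_mat_def)
  moreover have "M * ?D * mat_diag n (\<lambda>i. complex_of_real (d i)) = M * mat_diag n (\<lambda>i. 1)"
    using M d0 by (subst assoc_mult_mat[of _ n n _ n _ n])
      (simp_all cong: mat_diag_cong)
  ultimately show ?case
    using M by (intro exI[of _ "M * ?D"]) auto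
next
  case (Suc c)
  note M = Suc(3)
  from Suc(2) have "{i. i < n \<and> d i = 0} \<noteq> {}" by (metis card.empty nat.distinct(1))
  then obtain i0 where i0: "i0 < n" "d i0 = 0" by auto
  \<comment> \<open>A zero of \<open>d\<close> makes \<open>M\<close> singular, and a kernel vector
    of the adjoint is orthogonal to every column of \<open>M\<close>. Normalised, it replaces the
    zero column \<open>i0\<close>.\<close>
  have "det (mat_adjoint M) * det M = (\<Prod>i<n. complex_of_real ((d i)\<^sup>2))"
    using det_mult[of "mat_adjoint M" n M] M unfolding Suc(4) det_mat_diag by simp
  also have "\<dots> = 0" using i0 by (auto intro!: prod_zero)
  finally have "det (mat_adjoint M) = 0"
    using M by (auto simp: det_adjoint)
  then obtain v where v: "v \<in> carrier_vec n" "v \<noteq> 0\<^sub>v n" "mat_adjoint M *\<^sub>v v = 0\<^sub>v n"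
    using det_0_iff_vec_prod_zero[of "mat_adjoint M" n] M by auto
  have orth: "(\<Sum>k<n. cnj (M $$ (k, j)) * v $ k) = 0" if "j < n" for j
  proof -
    have "(mat_adjoint M *\<^sub>v v) $ j = 0" using that by (simp add: v(3))
    then show ?thesis using M v(1) that
      by (simp add: scalar_prod_def atLeast0LessThan)
  qed
  define s where "s = (\<Sum>k<n. (cmod (v $ k))\<^sup>2)"
  have "s > 0"
  proof -
    obtain k where "k < n" "v $ k \<noteq> 0" using v(1,2) by (metis eq_vecI carrier_vecD index_zero_vec)
    then show ?thesis unfolding s_def by (intro sum_pos2[of _ k]) auto
  qed
  define M' where "M' = mat n n (\<lambda>(i, j). if j = i0 then v $ i / complex_of_real (sqrt s) else M $$ (i, j))"
  define d' where "d' = d(i0 := 1)"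
  have M': "M' \<in> carrier_mat n n" by (simp add: M'_def)
  have gram: "(\<Sum>k<n. cnj (M $$ (k, i)) * M $$ (k, j)) = (if i = j then complex_of_real ((d i)\<^sup>2) else 0)"
    if "i < n" "j < n" for i j
    using gram_index[OF M that, symmetric] that unfolding Suc(4) by simp
  have "mat_adjoint M' * M' = mat_diag n (\<lambda>i. complex_of_real ((d' i)\<^sup>2))"
  proof (rule eq_matI)
    fix i j
    assume "i < dim_row (mat_diag n (\<lambda>i. complex_of_real ((d' i)\<^sup>2)))"
      "j < dim_col (mat_diag n (\<lambda>i. complex_of_real ((d' i)\<^sup>2)))"
    then have ij: "i < n" "j < n" by auto
    have vv: "(\<Sum>k<n. cnj (v $ k) / complex_of_real (sqrt s) * (v $ k / complex_of_real (sqrt s))) = 1"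
    proof -
      have "(\<Sum>k<n. cnj (v $ k) / complex_of_real (sqrt s) * (v $ k / complex_of_real (sqrt s)))
        = (\<Sum>k<n. complex_of_real ((cmod (v $ k))\<^sup>2)) / complex_of_real s"
        unfolding sum_divide_distrib
      proof (intro sum.cong refl)
        fix k
        have "complex_of_real (sqrt s) * complex_of_real (sqrt s) = complex_of_real s"
          using \<open>s > 0\<close> by (simp flip: of_real_mult)
        then show "cnj (v $ k) / complex_of_real (sqrt s) * (v $ k / complex_of_real (sqrt s))
          = complex_of_real ((cmod (v $ k))\<^sup>2) / complex_of_real s"
          by (simp add: complex_norm_square mult.commute del: of_real_power)
      qed
      also have "\<dots> = 1"
        using \<open>s > 0\<close> by (simp only: of_real_sum[symmetric] s_def[symmetric]) simp
      finally show ?thesis .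
    qed
    have vm: "(\<Sum>k<n. cnj (M $$ (k, i)) * (v $ k / complex_of_real (sqrt s))) = 0"
      using orth[OF ij(1)] by (simp flip: sum_divide_distrib add: times_divide_eq_right)
    have mv: "(\<Sum>k<n. cnj (v $ k) / complex_of_real (sqrt s) * M $$ (k, j)) = 0"
    proof -
      have "(\<Sum>k<n. cnj (v $ k) * M $$ (k, j)) = cnj (\<Sum>k<n. cnj (M $$ (k, j)) * v $ k)"
        by (simp add: mult.commute)
      then show ?thesis using orth[OF ij(2)] by (simp flip: sum_divide_distrib)
    qed
    have "(mat_adjoint M' * M') $$ (i, j) = (\<Sum>k<n. cnj (M' $$ (k, i)) * M' $$ (k, j))"
      by (rule gram_index[OF M' ij])
    also have "\<dots> = mat_diag n (\<lambda>i. complex_of_real ((d' i)\<^sup>2)) $$ (i, j)"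
      using ij vv vm mv gram[OF ij] unfolding M'_def d'_def
      by (cases "i = i0"; cases "j = i0") simp_all
    finally show "(mat_adjoint M' * M') $$ (i, j) = mat_diag n (\<lambda>i. complex_of_real ((d' i)\<^sup>2)) $$ (i, j)" .
  qed (use M' in auto)
  moreover have "c = card {i. i < n \<and> d' i = 0}"
  proof -
    have "{i. i < n \<and> d' i = 0} = {i. i < n \<and> d i = 0} - {i0}" by (auto simp: d'_def)
    then show ?thesis using Suc(2) i0 by simp
  qed
  ultimately obtain U where U: "unitary_mat n U" "M' = U * mat_diag n (\<lambda>i. complex_of_real (d' i))"
    using Suc(1)[OF _ M'] by blast
  have zero: "M $$ (k, i0) = 0" if "k < n" for k
  proof -
    have "(\<Sum>k<n. cnj (M $$ (k, i0)) * M $$ (k, i0)) = complex_of_real (\<Sum>k<n. (cmod (M $$ (k, i0)))\<^sup>2)"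
      by (simp only: of_real_sum complex_norm_square mult.commute)
    then have "(\<Sum>k<n. (cmod (M $$ (k, i0)))\<^sup>2) = 0"
      using gram[OF i0(1) i0(1)] i0(2) by (metis of_real_eq_0_iff power_zero_numeral)
    then show ?thesis using that by (simp add: sum_nonneg_eq_0_iff)
  qed
  \<comment> \<open>Erasing the inserted column recovers \<open>M\<close>, and turns the entry 1 of
    \<open>d'\<close> at \<open>i0\<close> back into the original 0.\<close>
  have "M = M' * mat_diag n (\<lambda>i. if i = i0 then 0 else 1)"
    using M zero by (subst mat_diag_mult_right[OF M']) (auto simp: M'_def intro!: eq_matI)
  also have "\<dots> = U * mat_diag n (\<lambda>i. complex_of_real (d i))"
    unfolding U(2) using unitary_carrier[OF U(1)] i0
    by (subst assoc_mult_mat[of _ n n _ n _ n])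
      (auto simp: d'_def intro!: arg_cong2[of _ _ _ _ "(*)"] eq_matI)
  finally show ?case using U(1) by blast
qed

section \<open>Direct sum with a one-dimensional block, and the spectral theorem by
  deflation\<close>

definition direct_sum_1 :: "nat \<Rightarrow> complex \<Rightarrow> complex mat \<Rightarrow> complex mat" where
  "direct_sum_1 n c V = mat (Suc n) (Suc n)
     (\<lambda>(i, j). case (i, j) of (0, 0) \<Rightarrow> c | (Suc i', Suc j') \<Rightarrow> V $$ (i', j') | _ \<Rightarrow> 0)"

lemma direct_sum_1_carrier [simp]: "direct_sum_1 n c V \<in> carrier_mat (Suc n) (Suc n)"
  by (simp add: direct_sum_1_def)

lemma direct_sum_1_mult:
  assumes "V \<in> carrier_mat n n" "V' \<in> carrier_mat n n"
  shows "direct_sum_1 n c V * direct_sum_1 n c' V' = direct_sum_1 n (c * c') (V * V')"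
proof (rule eq_matI)
  fix i j
  assume "i < dim_row (direct_sum_1 n (c * c') (V * V'))" "j < dim_col (direct_sum_1 n (c * c') (V * V'))"
  then have ij: "i < Suc n" "j < Suc n" by (auto simp: direct_sum_1_def)
  show "(direct_sum_1 n c V * direct_sum_1 n c' V') $$ (i, j) = direct_sum_1 n (c * c') (V * V') $$ (i, j)"
    using assms ij
    by (subst mult_mat_index[of _ "Suc n" "Suc n" _ "Suc n"], simp_all del: sum.lessThan_Suc index_mult_mat)
      (auto simp: direct_sum_1_def sum.lessThan_Suc_shift mult_mat_index[of _ n n _ n]
        simp del: sum.lessThan_Suc index_mult_mat(1) split: nat.splits)
qed (auto simp: direct_sum_1_def)

lemma direct_sum_1_adjoint:
  "V \<in> carrier_mat n n \<Longrightarrow> mat_adjoint (direct_sum_1 n c V) = direct_sum_1 n (cnj c) (mat_adjoint V)"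
  by (rule eq_matI) (auto simp: direct_sum_1_def split: nat.splits)

lemma direct_sum_1_diag:
  "direct_sum_1 n c (mat_diag n d) = mat_diag (Suc n) (case_nat c d)"
  by (rule eq_matI) (auto simp: direct_sum_1_def split: nat.splits)

lemma direct_sum_1_inject:
  assumes "direct_sum_1 n c V = direct_sum_1 n c' V'" "V \<in> carrier_mat n n" "V' \<in> carrier_mat n n"
  shows "V = V'"
proof (rule eq_matI)
  fix i j assume "i < dim_row V'" "j < dim_col V'"
  then show "V $$ (i, j) = V' $$ (i, j)"
    using arg_cong[OF assms(1), of "\<lambda>M. M $$ (Suc i, Suc j)"] assms(2,3)
    by (simp add: direct_sum_1_def)
qed (use assms in auto)

text \<open>Deflation: in an orthonormal basis starting with an eigenvector, the first column of the
  matrix vanishes below the diagonal. Normality then clears the first row as well, and the remaining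
  block is normal of smaller size.\<close>

theorem spectral_theorem_normal:
  assumes "A \<in> carrier_mat n n" "mat_adjoint A * A = A * mat_adjoint A"
  shows "\<exists>U d. unitary_mat n U \<and> A = U * mat_diag n d * mat_adjoint U"
  using assms
proof (induction n arbitrary: A)
  case 0
  then show ?case by (intro exI[of _ "1\<^sub>m 0"] exI) (auto intro!: eq_matI)
next
  case (Suc n)
  let ?N = "Suc n"
  note A = Suc.prems(1)
  note [simp] = assoc_mult_mat[of _ ?N ?N _ ?N _ ?N] mult_carrier_mat[of _ ?N ?N _ ?N]
    adjoint_mult[of _ ?N ?N _ ?N]
  obtain e where "poly (char_poly A) e = 0"
  proof -
    have "degree (char_poly A) = ?N" using degree_monic_char_poly[OF A] by simp
    then have "\<not> constant (poly (char_poly A))" by (simp add: constant_degree)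
    then show ?thesis using fundamental_theorem_of_algebra that by blast
  qed
  then obtain v where v: "v \<in> carrier_vec ?N" "v \<noteq> 0\<^sub>v ?N" "A *\<^sub>v v = e \<cdot>\<^sub>v v"
    using eigenvalue_root_char_poly[OF A] A unfolding eigenvalue_def eigenvector_def by auto
  define s where "s = (\<Sum>k<?N. (cmod (v $ k))\<^sup>2)"
  have "s > 0"
  proof -
    obtain k where "k < ?N" "v $ k \<noteq> 0" using v(1,2) by (metis eq_vecI carrier_vecD index_zero_vec)
    then show ?thesis unfolding s_def by (intro sum_pos2[of _ k]) auto
  qed
  \<comment> \<open>Applying \<open>orthogonal_columns_unitary\<close> to a matrix whose only
    nonzero column is \<open>v\<close> extends the normalised eigenvector to a unitary matrix
    \<open>U\<close>.\<close>
  define M where "M = mat ?N ?N (\<lambda>(i, j). if j = 0 then v $ i else 0)"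
  define d0 where "d0 = (\<lambda>i. if i = (0 :: nat) then sqrt s else 0)"
  let ?D0 = "mat_diag ?N (\<lambda>i. complex_of_real (d0 i))"
  have M: "M \<in> carrier_mat ?N ?N" by (simp add: M_def)
  have "mat_adjoint M * M = mat_diag ?N (\<lambda>i. complex_of_real ((d0 i)\<^sup>2))"
  proof (rule eq_matI)
    fix i j
    assume "i < dim_row (mat_diag ?N (\<lambda>i. complex_of_real ((d0 i)\<^sup>2)))"
      "j < dim_col (mat_diag ?N (\<lambda>i. complex_of_real ((d0 i)\<^sup>2)))"
    then have ij: "i < ?N" "j < ?N" by auto
    have s: "(\<Sum>k<?N. cnj (v $ k) * v $ k) = complex_of_real s"
      unfolding s_def by (simp only: of_real_sum complex_norm_square mult.commute)
    have s2: "(complex_of_real (sqrt s))\<^sup>2 = complex_of_real s"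
      using \<open>s > 0\<close> by (simp flip: of_real_power)
    show "(mat_adjoint M * M) $$ (i, j) = mat_diag ?N (\<lambda>i. complex_of_real ((d0 i)\<^sup>2)) $$ (i, j)"
      using ij s s2 unfolding gram_index[OF M ij]
      by (auto simp: M_def d0_def simp del: sum.lessThan_Suc)
  qed (use M in auto)
  then obtain U where U: "unitary_mat ?N U" "M = U * ?D0"
    using orthogonal_columns_unitary[OF M] by blast
  note Uc = unitary_carrier[OF U(1)]
  define B where "B = mat_adjoint U * (A * U)"
  have B: "B \<in> carrier_mat ?N ?N" using A Uc by (simp add: B_def)
  have "A * M = e \<cdot>\<^sub>m M"
  proof (rule eq_matI)
    fix i j assume "i < dim_row (e \<cdot>\<^sub>m M)" "j < dim_col (e \<cdot>\<^sub>m M)"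
    then have ij: "i < ?N" "j < ?N" by (auto simp: M_def)
    have "(A *\<^sub>v v) $ i = e * v $ i" using ij v by simp
    then have "(\<Sum>k<?N. A $$ (i, k) * v $ k) = e * v $ i"
      using A v(1) ij by (simp add: scalar_prod_def atLeast0LessThan)
    then show "(A * M) $$ (i, j) = (e \<cdot>\<^sub>m M) $$ (i, j)"
      using ij A M by (auto simp: mult_mat_index[of _ ?N ?N _ ?N] M_def
          simp del: sum.lessThan_Suc index_mult_mat(1))
  qed (use A M in auto)
  then have "B * ?D0 = e \<cdot>\<^sub>m ?D0"
    using A Uc U(1) by (simp add: B_def U(2)[symmetric] mult_smult_distrib[OF _ M, of _ ?N])
      (simp add: U(2) mult_smult_distrib[of _ ?N ?N _ ?N] unitary_left_cancel)
  then have "(B * ?D0) $$ (i, 0) = (e \<cdot>\<^sub>m ?D0) $$ (i, 0)" for i by simp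
  note BD0 = this
  have col: "B $$ (i, 0) = (if i = 0 then e else 0)" if "i < ?N" for i
    using BD0[of i] that B \<open>s > 0\<close> unfolding mat_diag_mult_right[OF B]
    by (simp add: d0_def split: if_splits)
  have norm: "mat_adjoint B * B = B * mat_adjoint B"
  proof -
    have "mat_adjoint B * B = mat_adjoint U * ((mat_adjoint A * A) * U)"
      using A Uc U(1) by (simp add: B_def unitary_right_cancel)
    also have "\<dots> = B * mat_adjoint B"
      unfolding Suc.prems(2) using A Uc U(1) by (simp add: B_def unitary_right_cancel)
    finally show ?thesis .
  qed
  \<comment> \<open>The corner entries of the two products in \<open>norm\<close> are the squared
    lengths of the first row and of the first column. The column only contributes the corner itself,
    so nothing is left for the rest of the row.\<close>
  have row: "B $$ (0, Suc j) = 0" if "j < n" for j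
  proof -
    have "(B * mat_adjoint B) $$ (0, 0) = (\<Sum>k<?N. B $$ (0, k) * cnj (B $$ (0, k)))"
      using B by (subst mult_mat_index[of _ ?N ?N _ ?N]) (auto intro!: sum.cong)
    also have "\<dots> = complex_of_real (\<Sum>k<?N. (cmod (B $$ (0, k)))\<^sup>2)"
      by (simp only: of_real_sum complex_norm_square)
    also have "\<dots> = complex_of_real ((cmod (B $$ (0, 0)))\<^sup>2 + (\<Sum>k<n. (cmod (B $$ (0, Suc k)))\<^sup>2))"
      by (subst sum.lessThan_Suc_shift) simp
    finally have 1: "(B * mat_adjoint B) $$ (0, 0) = \<dots>" .
    have "(mat_adjoint B * B) $$ (0, 0) = (\<Sum>k<?N. cnj (B $$ (k, 0)) * B $$ (k, 0))"
      by (rule gram_index[OF B]) auto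
    also have "\<dots> = cnj e * e"
      by (subst sum.lessThan_Suc_shift) (simp add: col)
    also have "\<dots> = complex_of_real ((cmod (B $$ (0, 0)))\<^sup>2)"
      using col[of 0] by (simp add: complex_norm_square mult.commute del: of_real_power)
    finally have "(\<Sum>k<n. (cmod (B $$ (0, Suc k)))\<^sup>2) = 0"
      using 1 norm by (simp del: of_real_power of_real_sum)
    then show ?thesis using that by (simp add: sum_nonneg_eq_0_iff)
  qed
  define D where "D = mat n n (\<lambda>(i, j). B $$ (Suc i, Suc j))"
  have D: "D \<in> carrier_mat n n" by (simp add: D_def)
  have BD: "B = direct_sum_1 n e D"
    using B col row by (auto simp: direct_sum_1_def D_def intro!: eq_matI split: nat.splits)
  have "mat_adjoint D * D = D * mat_adjoint D"
    using norm D unfolding BD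
    by (simp add: direct_sum_1_adjoint direct_sum_1_mult)
      (auto intro!: direct_sum_1_inject[of n "cnj e * e" _ "e * cnj e"] simp: mult_carrier_mat[of _ n n _ n])
  then obtain V d where V: "unitary_mat n V" "D = V * mat_diag n d * mat_adjoint V"
    using Suc.IH[OF D] by blast
  note Vc = unitary_carrier[OF V(1)]
  define V' where "V' = direct_sum_1 n 1 V"
  have V': "unitary_mat ?N V'"
  proof -
    have "1\<^sub>m ?N = mat_diag ?N (case_nat 1 (\<lambda>i. 1))"
      by (auto intro!: eq_matI split: nat.splits)
    also have "\<dots> = direct_sum_1 n 1 (1\<^sub>m n)"
      using direct_sum_1_diag[of n 1 "\<lambda>i. 1"] by simp
    finally show ?thesis
      using Vc unitary_left[OF V(1)]
      by (simp add: unitary_mat_def V'_def direct_sum_1_adjoint direct_sum_1_mult)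
  qed
  have BV: "B = V' * mat_diag ?N (case_nat e d) * mat_adjoint V'"
    using Vc unfolding BD V(2) V'_def direct_sum_1_diag[symmetric]
    by (simp add: direct_sum_1_adjoint direct_sum_1_mult mult_carrier_mat[of _ n n _ n] del: assoc_mult_mat)
  have "A = U * B * mat_adjoint U"
    using A Uc U(1) unitary_right[OF U(1)] by (simp add: B_def unitary_right_cancel)
  also have "\<dots> = (U * V') * mat_diag ?N (case_nat e d) * mat_adjoint (U * V')"
    unfolding BV using Uc unitary_carrier[OF V'] by simp
  finally show ?case
    using unitary_mult[OF U(1) V'] by blast
qed

section \<open>Block matrices with respect to the last tensor factor\<close>

text \<open>The blocks interleave: the parity of an index is its coordinate in the last tensor factor.\<close>

definition block2 :: "nat \<Rightarrow> complex mat \<Rightarrow> complex mat \<Rightarrow> complex mat \<Rightarrow> complex mat \<Rightarrow> complex mat" where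
  "block2 N A B C D = mat (N * 2) (N * 2) (\<lambda>(i, j).
     (if even i then if even j then A else B else if even j then C else D) $$ (i div 2, j div 2))"

abbreviation bdiag :: "nat \<Rightarrow> complex mat \<Rightarrow> complex mat \<Rightarrow> complex mat" where
  "bdiag N A B \<equiv> block2 N A (0\<^sub>m N N) (0\<^sub>m N N) B"

lemma block2_carrier [simp]: "block2 N A B C D \<in> carrier_mat (N * 2) (N * 2)"
  by (simp add: block2_def)

lemma block2_dim [simp]:
  "dim_row (block2 N A B C D) = N * 2" "dim_col (block2 N A B C D) = N * 2"
  by (simp_all add: block2_def)

lemma block2_index:
  assumes "i < N * 2" "j < N * 2"
  shows "block2 N A B C D $$ (i, j) =
    (if even i then if even j then A else B else if even j then C else D) $$ (i div 2, j div 2)"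
  using assms by (simp add: block2_def)

lemma sum_even_odd:
  "(\<Sum>i<N * 2. f i) = (\<Sum>i<N. f (2 * i)) + (\<Sum>i<N. f (Suc (2 * i)))" for f :: "nat \<Rightarrow> 'a :: comm_monoid_add"
  by (induction N) (auto simp: ac_simps)

lemma prod_even_odd:
  "(\<Prod>i<N * 2. f i) = (\<Prod>i<N. f (2 * i)) * (\<Prod>i<N. f (Suc (2 * i)))" for f :: "nat \<Rightarrow> 'a :: comm_monoid_mult"
  by (induction N) (auto simp: ac_simps)

lemma block2_mult:
  assumes "A \<in> carrier_mat N N" "B \<in> carrier_mat N N" "C \<in> carrier_mat N N" "D \<in> carrier_mat N N"
    and "A' \<in> carrier_mat N N" "B' \<in> carrier_mat N N" "C' \<in> carrier_mat N N" "D' \<in> carrier_mat N N"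
  shows "block2 N A B C D * block2 N A' B' C' D' =
    block2 N (A * A' + B * C') (A * B' + B * D') (C * A' + D * C') (C * B' + D * D')"
proof (rule eq_matI)
  fix i j
  assume "i < dim_row (block2 N (A * A' + B * C') (A * B' + B * D') (C * A' + D * C') (C * B' + D * D'))"
    "j < dim_col (block2 N (A * A' + B * C') (A * B' + B * D') (C * A' + D * C') (C * B' + D * D'))"
  then have ij: "i < N * 2" "j < N * 2" by auto
  then have ij2: "i div 2 < N" "j div 2 < N" by auto
  show "(block2 N A B C D * block2 N A' B' C' D') $$ (i, j) =
    block2 N (A * A' + B * C') (A * B' + B * D') (C * A' + D * C') (C * B' + D * D') $$ (i, j)"
    using assms ij ij2
    by (subst mult_mat_index[of _ "N * 2" "N * 2" _ "N * 2"])
      (simp_all add: sum_even_odd block2_index mult_mat_index[of _ N N _ N] mult_carrier_mat[of _ N N _ N]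
        del: index_mult_mat(1))
qed auto

lemma bdiag_mult:
  assumes "A \<in> carrier_mat N N" "B \<in> carrier_mat N N" "A' \<in> carrier_mat N N" "B' \<in> carrier_mat N N"
  shows "bdiag N A B * bdiag N A' B' = bdiag N (A * A') (B * B')"
  using assms by (subst block2_mult) (auto intro!: arg_cong2[of _ _ _ _ "\<lambda>x y. bdiag N x y"])

lemma bdiag_mult_block2:
  assumes "A \<in> carrier_mat N N" "B \<in> carrier_mat N N"
    and "A' \<in> carrier_mat N N" "B' \<in> carrier_mat N N" "C' \<in> carrier_mat N N" "D' \<in> carrier_mat N N"
  shows "bdiag N A B * block2 N A' B' C' D' = block2 N (A * A') (A * B') (B * C') (B * D')"
  using assms by (subst block2_mult) (simp_all add: mult_carrier_mat[of _ N N _ N])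

lemma block2_mult_bdiag:
  assumes "A \<in> carrier_mat N N" "B \<in> carrier_mat N N"
    and "A' \<in> carrier_mat N N" "B' \<in> carrier_mat N N" "C' \<in> carrier_mat N N" "D' \<in> carrier_mat N N"
  shows "block2 N A' B' C' D' * bdiag N A B = block2 N (A' * A) (B' * B) (C' * A) (D' * B)"
  using assms by (subst block2_mult) (simp_all add: mult_carrier_mat[of _ N N _ N])

lemma block2_adjoint:
  assumes "A \<in> carrier_mat N N" "B \<in> carrier_mat N N" "C \<in> carrier_mat N N" "D \<in> carrier_mat N N"
  shows "mat_adjoint (block2 N A B C D) =
    block2 N (mat_adjoint A) (mat_adjoint C) (mat_adjoint B) (mat_adjoint D)"
proof (rule eq_matI)
  fix i j
  assume "i < dim_row (block2 N (mat_adjoint A) (mat_adjoint C) (mat_adjoint B) (mat_adjoint D))"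
    "j < dim_col (block2 N (mat_adjoint A) (mat_adjoint C) (mat_adjoint B) (mat_adjoint D))"
  then have ij: "i < N * 2" "j < N * 2" by auto
  then have "i div 2 < N" "j div 2 < N" by auto
  with ij show "mat_adjoint (block2 N A B C D) $$ (i, j) =
    block2 N (mat_adjoint A) (mat_adjoint C) (mat_adjoint B) (mat_adjoint D) $$ (i, j)"
    using assms by (simp add: block2_index)
qed auto

lemma block2_inject:
  assumes "block2 N A B C D = block2 N A' B' C' D'"
    and "A \<in> carrier_mat N N" "B \<in> carrier_mat N N" "C \<in> carrier_mat N N" "D \<in> carrier_mat N N"
    and "A' \<in> carrier_mat N N" "B' \<in> carrier_mat N N" "C' \<in> carrier_mat N N" "D' \<in> carrier_mat N N"
  shows "A = A' \<and> B = B' \<and> C = C' \<and> D = D'"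
proof -
  have *: "A $$ (i, j) = A' $$ (i, j) \<and> B $$ (i, j) = B' $$ (i, j) \<and>
    C $$ (i, j) = C' $$ (i, j) \<and> D $$ (i, j) = D' $$ (i, j)" if "i < N" "j < N" for i j
  proof -
    have eq: "block2 N A B C D $$ (2 * i + a, 2 * j + b) = block2 N A' B' C' D' $$ (2 * i + a, 2 * j + b)" for a b
      using assms(1) by simp
    show ?thesis
      using eq[of 0 0] eq[of 0 1] eq[of 1 0] eq[of 1 1] that by (simp add: block2_index)
  qed
  show ?thesis
    using assms(2-) * by (auto intro!: eq_matI)
qed

lemma block2_exists:
  assumes "G \<in> carrier_mat (N * 2) (N * 2)"
  obtains A B C D where "G = block2 N A B C D" "A \<in> carrier_mat N N" "B \<in> carrier_mat N N"
    "C \<in> carrier_mat N N" "D \<in> carrier_mat N N"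
proof
  let ?f = "\<lambda>a b. mat N N (\<lambda>(i, j). G $$ (2 * i + a, 2 * j + b))"
  show "G = block2 N (?f 0 0) (?f 0 1) (?f 1 0) (?f 1 1)"
  proof (rule eq_matI)
    fix i j
    assume "i < dim_row (block2 N (?f 0 0) (?f 0 1) (?f 1 0) (?f 1 1))"
      "j < dim_col (block2 N (?f 0 0) (?f 0 1) (?f 1 0) (?f 1 1))"
    then have "i < N * 2" "j < N * 2" by auto
    moreover from this have "i div 2 < N" "j div 2 < N" by auto
    ultimately show "G $$ (i, j) = block2 N (?f 0 0) (?f 0 1) (?f 1 0) (?f 1 1) $$ (i, j)"
      by (auto simp: block2_index)
  qed (use assms in auto)
qed auto

lemma bdiag_mat_diag:
  "bdiag N (mat_diag N f) (mat_diag N g) =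
    mat_diag (N * 2) (\<lambda>i. if even i then f (i div 2) else g (i div 2))"
proof (rule eq_matI)
  fix i j
  assume "i < dim_row (mat_diag (N * 2) (\<lambda>i. if even i then f (i div 2) else g (i div 2)))"
    "j < dim_col (mat_diag (N * 2) (\<lambda>i. if even i then f (i div 2) else g (i div 2)))"
  then have ij: "i < N * 2" "j < N * 2" by auto
  then have ij2: "i div 2 < N" "j div 2 < N" by auto
  have "i = j \<longleftrightarrow> i div 2 = j div 2 \<and> even i = even j"
    by (metis bit_eq_rec)
  with ij ij2 show "bdiag N (mat_diag N f) (mat_diag N g) $$ (i, j) =
      mat_diag (N * 2) (\<lambda>i. if even i then f (i div 2) else g (i div 2)) $$ (i, j)"
    by (auto simp: block2_index)
qed auto

lemma bdiag_one: "bdiag N (1\<^sub>m N) (1\<^sub>m N) = 1\<^sub>m (N * 2)"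
  using bdiag_mat_diag[of N "\<lambda>_. 1" "\<lambda>_. 1"] by simp

lemma unitary_bdiag:
  assumes "unitary_mat N A" "unitary_mat N B"
  shows "unitary_mat (N * 2) (bdiag N A B)"
proof -
  have "mat_adjoint (0\<^sub>m N N :: complex mat) = 0\<^sub>m N N" by (rule eq_matI) auto
  then show ?thesis
    using assms by (simp add: unitary_mat_def block2_adjoint bdiag_mult bdiag_one)
qed

lemma bdiag_adjoint:
  assumes "A \<in> carrier_mat N N" "B \<in> carrier_mat N N"
  shows "mat_adjoint (bdiag N A B) = bdiag N (mat_adjoint A) (mat_adjoint B)"
proof -
  have "mat_adjoint (0\<^sub>m N N :: complex mat) = 0\<^sub>m N N" by (rule eq_matI) auto
  then show ?thesis using assms by (simp add: block2_adjoint)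
qed

lemma block2_add:
  assumes "A \<in> carrier_mat N N" "B \<in> carrier_mat N N" "C \<in> carrier_mat N N" "D \<in> carrier_mat N N"
    and "A' \<in> carrier_mat N N" "B' \<in> carrier_mat N N" "C' \<in> carrier_mat N N" "D' \<in> carrier_mat N N"
  shows "block2 N A B C D + block2 N A' B' C' D' = block2 N (A + A') (B + B') (C + C') (D + D')"
proof (rule eq_matI)
  fix i j
  assume "i < dim_row (block2 N (A + A') (B + B') (C + C') (D + D'))"
    "j < dim_col (block2 N (A + A') (B + B') (C + C') (D + D'))"
  then have ij: "i < N * 2" "j < N * 2" by auto
  then have "i div 2 < N" "j div 2 < N" by auto
  with ij assms show "(block2 N A B C D + block2 N A' B' C' D') $$ (i, j) =
    block2 N (A + A') (B + B') (C + C') (D + D') $$ (i, j)"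
    by (simp add: block2_index)
qed auto

lemma bdiag_smult:
  assumes "A \<in> carrier_mat N N" "B \<in> carrier_mat N N"
  shows "bdiag N (c \<cdot>\<^sub>m A) (c \<cdot>\<^sub>m B) = c \<cdot>\<^sub>m bdiag N A B"
proof (rule eq_matI)
  fix i j
  assume "i < dim_row (c \<cdot>\<^sub>m bdiag N A B)" "j < dim_col (c \<cdot>\<^sub>m bdiag N A B)"
  then have ij: "i < N * 2" "j < N * 2" by auto
  then have "i div 2 < N" "j div 2 < N" by auto
  with ij assms show "bdiag N (c \<cdot>\<^sub>m A) (c \<cdot>\<^sub>m B) $$ (i, j) = (c \<cdot>\<^sub>m bdiag N A B) $$ (i, j)"
    by (auto simp: block2_index)
qed auto

text \<open>The right factor of \<open>kron\<close> carries the fast index, which for a 2 by 2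
  factor is the parity used by \<open>block2\<close>.\<close>

lemma kron_block2:
  assumes A: "A \<in> carrier_mat N N" and L: "L \<in> carrier_mat 2 2"
  shows "A \<otimes>\<^sub>K L = block2 N (L $$ (0, 0) \<cdot>\<^sub>m A) (L $$ (0, 1) \<cdot>\<^sub>m A) (L $$ (1, 0) \<cdot>\<^sub>m A) (L $$ (1, 1) \<cdot>\<^sub>m A)"
    (is "_ = ?B")
proof (rule eq_matI)
  fix i j
  assume "i < dim_row ?B" "j < dim_col ?B"
  then have ij: "i < N * 2" "j < N * 2" by auto
  then have "i div 2 < N" "j div 2 < N" by auto
  with ij A L show "(A \<otimes>\<^sub>K L) $$ (i, j) = ?B $$ (i, j)"
    by (auto simp: kron_def block2_index mod_2_eq_odd)
qed (use A L in \<open>auto simp: kron_def\<close>)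

lemma kron_Id2:
  assumes "A \<in> carrier_mat N N"
  shows "A \<otimes>\<^sub>K Id2 = bdiag N A A"
proof -
  have "0 \<cdot>\<^sub>m A = 0\<^sub>m N N" "1 \<cdot>\<^sub>m A = A" using assms by (auto intro!: eq_matI)
  then show ?thesis using assms by (simp add: kron_block2)
qed

lemma kron_X:
  assumes "A \<in> carrier_mat N N"
  shows "A \<otimes>\<^sub>K pauli_X = block2 N (0\<^sub>m N N) A A (0\<^sub>m N N)"
proof -
  have "0 \<cdot>\<^sub>m A = 0\<^sub>m N N" "1 \<cdot>\<^sub>m A = A" using assms by (auto intro!: eq_matI)
  then show ?thesis using assms
    by (simp add: kron_block2) (simp add: pauli_X_def mat_of_rows_list_def)
qed

lemma kron_Z:
  assumes "A \<in> carrier_mat N N"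
  shows "A \<otimes>\<^sub>K pauli_Z = bdiag N A (- A)"
proof -
  have "0 \<cdot>\<^sub>m A = 0\<^sub>m N N" "1 \<cdot>\<^sub>m A = A" "(-1) \<cdot>\<^sub>m A = - A" using assms by (auto intro!: eq_matI)
  then show ?thesis using assms
    by (simp add: kron_block2) (simp add: pauli_Z_def mat_of_rows_list_def)
qed

lemma kron_pow_Id2: "kron_pow Id2 k = 1\<^sub>m (2 ^ k)"
proof (induction k)
  case (Suc k)
  then show ?case
    using kron_Id2[of "1\<^sub>m (2 ^ k)" "2 ^ k"] by (simp add: bdiag_one mult.commute)
qed simp

text \<open>Diagonalising both blocks by the spectral theorem reduces the claim to a diagonal
  matrix, whose entries at even and odd positions give the two determinants.\<close>

lemma det_bdiag:
  assumes A: "unitary_mat N A" and B: "unitary_mat N B"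
  shows "det (bdiag N A B) = det A * det B"
proof -
  have diagonalise: "\<exists>U d. unitary_mat N U \<and> M = U * mat_diag N d * mat_adjoint U \<and> det M = (\<Prod>i<N. d i)"
    if M: "unitary_mat N M" for M
  proof -
    obtain U d where U: "unitary_mat N U" "M = U * mat_diag N d * mat_adjoint U"
      using spectral_theorem_normal[of M N] unitary_left[OF M] unitary_right[OF M] unitary_carrier[OF M]
      by auto
    have "det M = det (U * mat_adjoint U) * det (mat_diag N d)"
      using unitary_carrier[OF U(1)]
      unfolding U(2) by (simp add: det_mult[of _ N] mult_carrier_mat[of _ N N _ N])
    then show ?thesis using U unitary_right[OF U(1)] by (auto simp: det_mat_diag)
  qed
  obtain U d where U: "unitary_mat N U" "A = U * mat_diag N d * mat_adjoint U" "det A = (\<Prod>i<N. d i)"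
    using diagonalise[OF A] by blast
  obtain V e where V: "unitary_mat N V" "B = V * mat_diag N e * mat_adjoint V" "det B = (\<Prod>i<N. e i)"
    using diagonalise[OF B] by blast
  let ?P = "bdiag N U V" and ?D = "bdiag N (mat_diag N d) (mat_diag N e)"
  note P = unitary_bdiag[OF U(1) V(1)]
  have "bdiag N A B = ?P * ?D * mat_adjoint ?P"
    using unitary_carrier[OF U(1)] unitary_carrier[OF V(1)] unfolding U(2) V(2)
    by (simp add: bdiag_mult bdiag_adjoint mult_carrier_mat[of _ N N _ N])
  then have "det (bdiag N A B) = det (?P * mat_adjoint ?P) * det ?D"
    using unitary_carrier[OF P]
    by (simp add: det_mult[of _ "N * 2"] mult_carrier_mat[of _ "N * 2" "N * 2" _ "N * 2"])
  then show ?thesis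
    using unitary_right[OF P] U(3) V(3) by (simp add: bdiag_mat_diag det_mat_diag prod_even_odd)
qed

section \<open>The cosine-sine decomposition\<close>

text \<open>The factor \<open>\<i>\<close> replaces the usual real rotation, so that this is the
  exponential of a real diagonal matrix times \<open>\<i>\<close>, tensored with
  \<open>pauli_X\<close>.\<close>

definition cs_mat :: "nat \<Rightarrow> (nat \<Rightarrow> real) \<Rightarrow> complex mat" where
  "cs_mat N \<theta> = block2 N
     (mat_diag N (\<lambda>i. complex_of_real (cos (\<theta> i)))) (mat_diag N (\<lambda>i. \<i> * complex_of_real (sin (\<theta> i))))
     (mat_diag N (\<lambda>i. \<i> * complex_of_real (sin (\<theta> i)))) (mat_diag N (\<lambda>i. complex_of_real (cos (\<theta> i))))"

lemma cs_mat_carrier [simp]: "cs_mat N \<theta> \<in> carrier_mat (N * 2) (N * 2)"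
  by (simp add: cs_mat_def)

lemma mat_diag_add: "mat_diag n f + mat_diag n g = mat_diag n (\<lambda>i. f i + g i)"
  for f :: "nat \<Rightarrow> complex"
  by (rule eq_matI) auto

lemma mat_diag_zero: "mat_diag n (\<lambda>i. 0) = 0\<^sub>m n n"
  by (rule eq_matI) auto

lemma cos_sin_complex: "complex_of_real (cos t) * complex_of_real (cos t) +
  complex_of_real (sin t) * complex_of_real (sin t) = 1"
  by (metis of_real_1 of_real_add of_real_mult power2_eq_square sin_cos_squared_add2)

lemma unitary_cs_mat: "unitary_mat (N * 2) (cs_mat N \<theta>)"
  by (simp add: unitary_mat_def cs_mat_def block2_adjoint block2_mult mat_diag_add
      cos_sin_complex mat_diag_zero bdiag_one algebra_simps flip: bdiag_one)

text \<open>The first block column \<open>P\<close>, \<open>R\<close> of \<open>G\<close> has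
  orthonormal columns, so one unitary \<open>V\<close> diagonalises both Gram matrices, with
  eigenvalues adding up to 1. Hence \<open>P * V\<close> and \<open>R * V\<close> have orthogonal
  columns of lengths |cos| and |sin|, and completing them to unitary matrices yields
  \<open>A1\<close> and \<open>A2\<close>.\<close>

theorem cosine_sine_decomposition:
  assumes G: "unitary_mat (N * 2) G"
  obtains A1 A2 B1 B2 \<theta> where "unitary_mat N A1" "unitary_mat N A2" "unitary_mat N B1" "unitary_mat N B2"
    "G = bdiag N A1 A2 * cs_mat N \<theta> * bdiag N B1 B2"
proof -
  let ?M = "N * 2"
  note [simp] = assoc_mult_mat[of _ N N _ N _ N] mult_carrier_mat[of _ N N _ N]
    adjoint_mult[of _ N N _ N]
  note cN = mult_carrier_mat[of _ ?M ?M _ ?M] and aN = assoc_mult_mat[of _ ?M ?M _ ?M _ ?M]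
  obtain P Q R S where PQRS: "G = block2 N P Q R S" "P \<in> carrier_mat N N" "Q \<in> carrier_mat N N"
    "R \<in> carrier_mat N N" "S \<in> carrier_mat N N"
    using block2_exists[OF unitary_carrier[OF G]] by blast
  have PR: "mat_adjoint P * P + mat_adjoint R * R = 1\<^sub>m N"
  proof -
    have "block2 N (mat_adjoint P * P + mat_adjoint R * R) (mat_adjoint P * Q + mat_adjoint R * S)
       (mat_adjoint Q * P + mat_adjoint S * R) (mat_adjoint Q * Q + mat_adjoint S * S)
       = bdiag N (1\<^sub>m N) (1\<^sub>m N)"
      using unitary_left[OF G] PQRS by (simp add: block2_adjoint block2_mult bdiag_one)
    from block2_inject[OF this] show ?thesis using PQRS by simp
  qed
  obtain V d where V: "unitary_mat N V" "mat_adjoint P * P = V * mat_diag N d * mat_adjoint V"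
    using spectral_theorem_normal[of "mat_adjoint P * P" N] PQRS(2) by auto
  note Vc = unitary_carrier[OF V(1)]
  have D1: "mat_adjoint (P * V) * (P * V) = mat_diag N d"
  proof -
    have "mat_adjoint (P * V) * (P * V) = mat_adjoint V * ((mat_adjoint P * P) * V)"
      using PQRS Vc by simp
    also have "\<dots> = mat_diag N d"
      unfolding V(2) using Vc V(1) unitary_left[OF V(1)] by (simp add: unitary_left_cancel)
    finally show ?thesis .
  qed
  have D2: "mat_adjoint (R * V) * (R * V) = mat_diag N (\<lambda>i. 1 - d i)"
  proof -
    have "mat_adjoint (P * V) * (P * V) + mat_adjoint (R * V) * (R * V)
      = mat_adjoint V * ((mat_adjoint P * P + mat_adjoint R * R) * V)"
      using PQRS Vc by (simp add: add_mult_distrib_mat[of _ N N _ _ N] mult_add_distrib_mat[of _ N N _ N])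
    also have "\<dots> = 1\<^sub>m N" unfolding PR using unitary_left[OF V(1)] Vc by simp
    finally have sum: "mat_diag N d + mat_adjoint (R * V) * (R * V) = 1\<^sub>m N"
      unfolding D1 .
    show ?thesis
    proof (rule eq_matI)
      fix i j assume "i < dim_row (mat_diag N (\<lambda>i. 1 - d i))" "j < dim_col (mat_diag N (\<lambda>i. 1 - d i))"
      then have ij: "i < N" "j < N" by auto
      then have "(mat_diag N d + mat_adjoint (R * V) * (R * V)) $$ (i, j) =
        mat_diag N d $$ (i, j) + (mat_adjoint (R * V) * (R * V)) $$ (i, j)"
        using PQRS Vc by (intro index_add_mat) auto
      then show "(mat_adjoint (R * V) * (R * V)) $$ (i, j) = mat_diag N (\<lambda>i. 1 - d i) $$ (i, j)"
        unfolding sum using ij by (auto simp: algebra_simps)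
    qed (use PQRS Vc in auto)
  qed
  \<comment> \<open>A diagonal entry of a Gram matrix is the squared length of a column. This makes
    both \<open>d i\<close> and \<open>1 - d i\<close> real and nonnegative, hence a squared cosine
    and sine.\<close>
  have gram: "\<exists>r\<ge>0. f i = complex_of_real r"
    if "mat_adjoint X * X = mat_diag N f" "X \<in> carrier_mat N N" "i < N" for X f i
  proof -
    have "f i = (\<Sum>k<N. cnj (X $$ (k, i)) * X $$ (k, i))"
      using gram_index[OF that(2) that(3) that(3)] that(3) unfolding that(1) by simp
    also have "\<dots> = complex_of_real (\<Sum>k<N. (cmod (X $$ (k, i)))\<^sup>2)"
      by (simp only: of_real_sum complex_norm_square mult.commute)
    finally show ?thesis by (metis sum_nonneg zero_le_power2)
  qed
  have "\<exists>t. d i = complex_of_real ((cos t)\<^sup>2) \<and> 1 - d i = complex_of_real ((sin t)\<^sup>2)" if i: "i < N" for i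
  proof -
    obtain r where r: "r \<ge> 0" "d i = complex_of_real r"
      using gram[OF D1 _ i] PQRS Vc by auto
    obtain r' where r': "r' \<ge> 0" "1 - d i = complex_of_real r'"
      using gram[OF D2 _ i] PQRS Vc by auto
    have "complex_of_real (r + r') = 1" using r(2) r'(2) by (metis add.commute diff_add_cancel of_real_add)
    then have "r + r' = 1" using of_real_eq_1_iff by blast
    then have "(sqrt r)\<^sup>2 + (sqrt r')\<^sup>2 = 1" using r r' by simp
    then obtain t where t: "sqrt r = cos t" "sqrt r' = sin t"
      using sincos_total_2pi by metis
    show ?thesis
      by (rule exI[of _ t]) (use r r' in \<open>simp flip: t add: of_real_power[symmetric] del: of_real_power\<close>)
  qed
  then obtain \<theta> where \<theta>: "\<And>i. i < N \<Longrightarrow> d i = complex_of_real ((cos (\<theta> i))\<^sup>2)"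
    "\<And>i. i < N \<Longrightarrow> 1 - d i = complex_of_real ((sin (\<theta> i))\<^sup>2)"
    by metis
  obtain A1 where A1: "unitary_mat N A1" "P * V = A1 * mat_diag N (\<lambda>i. complex_of_real (cos (\<theta> i)))"
    using orthogonal_columns_unitary[of "P * V" N "\<lambda>i. cos (\<theta> i)"] PQRS Vc \<theta>(1) D1
    by (auto cong: mat_diag_cong)
  obtain A2' where A2': "unitary_mat N A2'" "R * V = A2' * mat_diag N (\<lambda>i. complex_of_real (sin (\<theta> i)))"
    using orthogonal_columns_unitary[of "R * V" N "\<lambda>i. sin (\<theta> i)"] PQRS Vc \<theta>(2) D2
    by (auto cong: mat_diag_cong)
  \<comment> \<open>This phase cancels the factor \<open>\<i>\<close> in front of the sines in
    \<open>cs_mat\<close>.\<close>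
  define A2 where "A2 = (- \<i>) \<cdot>\<^sub>m A2'"
  have A2: "unitary_mat N A2"
    unfolding A2_def using A2'(1) by (intro unitary_smult) auto
  have "- (\<i> * x * (\<i> * y)) = x * y" for x y :: complex
    by (simp add: complex_eq_iff)
  then have RV: "R * V = A2 * mat_diag N (\<lambda>i. \<i> * complex_of_real (sin (\<theta> i)))"
    unfolding A2'(2) A2_def using unitary_carrier[OF A2'(1)]
    by (subst (1 2) mat_diag_mult_right[of _ N N]) (auto intro!: eq_matI)
  note A1c = unitary_carrier[OF A1(1)] and A2c = unitary_carrier[OF A2]
  \<comment> \<open>What remains of \<open>G\<close> after stripping the known factors. By the
    choice of \<open>A1\<close> and \<open>A2\<close>, the matrix behind the first factor has the
    same first block column as \<open>cs_mat N \<theta>\<close>, so that of \<open>Y\<close> is the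
    one of the identity.\<close>
  define Y where "Y = mat_adjoint (cs_mat N \<theta>) * (bdiag N (mat_adjoint A1) (mat_adjoint A2) * (G * bdiag N V (1\<^sub>m N)))"
  have Y: "unitary_mat ?M Y"
    unfolding Y_def
    by (intro unitary_mult unitary_adjoint unitary_cs_mat unitary_bdiag A1(1) A2 G V(1) unitary_one)
  obtain Q' S' where Y_eq: "Y = block2 N (1\<^sub>m N) Q' (0\<^sub>m N N) S'" "Q' \<in> carrier_mat N N" "S' \<in> carrier_mat N N"
  proof -
    let ?C = "mat_diag N (\<lambda>i. complex_of_real (cos (\<theta> i)))" and ?S = "mat_diag N (\<lambda>i. \<i> * complex_of_real (sin (\<theta> i)))"
    have "bdiag N (mat_adjoint A1) (mat_adjoint A2) * (G * bdiag N V (1\<^sub>m N))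
      = block2 N ?C (mat_adjoint A1 * Q) ?S (mat_adjoint A2 * S)"
      using PQRS Vc A1c A2c A1(2) RV A1(1) A2
      by (simp add: block2_mult_bdiag bdiag_mult_block2 unitary_left_cancel)
    then have "Y = block2 N (1\<^sub>m N)
        (mat_adjoint ?C * (mat_adjoint A1 * Q) + mat_adjoint ?S * (mat_adjoint A2 * S))
        (0\<^sub>m N N) (mat_adjoint ?S * (mat_adjoint A1 * Q) + mat_adjoint ?C * (mat_adjoint A2 * S))"
      using PQRS A1c A2c unfolding Y_def cs_mat_def
      by (simp add: block2_adjoint block2_mult mat_diag_add cos_sin_complex mat_diag_zero algebra_simps)
    with that show ?thesis using PQRS A1c A2c by simp
  qed
  \<comment> \<open>The left side is the Gram matrix of \<open>Y\<close>. Its upper right block is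
    \<open>Q'\<close> itself, so unitarity forces \<open>Q'\<close> to vanish and \<open>S'\<close>
    to be unitary.\<close>
  have "block2 N (1\<^sub>m N) Q' (mat_adjoint Q') (mat_adjoint Q' * Q' + mat_adjoint S' * S') = bdiag N (1\<^sub>m N) (1\<^sub>m N)"
  proof -
    have "mat_adjoint (0\<^sub>m N N :: complex mat) = 0\<^sub>m N N" by (rule eq_matI) auto
    then show ?thesis
      using unitary_left[OF Y] Y_eq by (simp add: block2_adjoint block2_mult bdiag_one)
  qed
  from block2_inject[OF this] have Q': "Q' = 0\<^sub>m N N" "mat_adjoint Q' * Q' + mat_adjoint S' * S' = 1\<^sub>m N"
    using Y_eq(2,3) by auto
  have S': "unitary_mat N S'"
    using Q' Y_eq(3) by (simp add: unitary_mat_def)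
  have "bdiag N A1 A2 * (cs_mat N \<theta> * Y) = G * bdiag N V (1\<^sub>m N)"
    using unitary_right_cancel[OF unitary_cs_mat] unitary_right_cancel[OF unitary_bdiag[OF A1(1) A2]]
      unitary_carrier[OF G] A1c A2c
    by (simp add: Y_def bdiag_adjoint[symmetric] cN)
  moreover have "G * bdiag N V (1\<^sub>m N) * bdiag N (mat_adjoint V) (1\<^sub>m N) = G"
    using unitary_carrier[OF G] Vc unitary_right[OF V(1)]
    by (simp add: aN bdiag_mult bdiag_one)
  moreover have "Y * bdiag N (mat_adjoint V) (1\<^sub>m N) = bdiag N (mat_adjoint V) S'"
    using Y_eq(3) Vc unfolding Y_eq(1) Q'(1) by (simp add: bdiag_mult)
  ultimately have "G = bdiag N A1 A2 * (cs_mat N \<theta> * Y) * bdiag N (mat_adjoint V) (1\<^sub>m N)"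
    and Y_V: "Y * bdiag N (mat_adjoint V) (1\<^sub>m N) = bdiag N (mat_adjoint V) S'" by simp_all
  then have "G = bdiag N A1 A2 * cs_mat N \<theta> * bdiag N (mat_adjoint V) S'"
    using unitary_carrier[OF Y] by (simp add: aN cN Y_V)
  then show ?thesis
    using that A1(1) A2 S' unitary_adjoint[OF V(1)] by blast
qed

section \<open>Factorisation of block diagonal special unitary matrices\<close>

lemma unit_complex_cis:
  assumes "cmod z = 1"
  obtains t where "z = cis t"
proof -
  have "z \<noteq> 0" using assms by auto
  then have "cis (Arg z) = z" using assms by (simp add: cis_Arg sgn_div_norm)
  then show ?thesis using that by metis
qed

text \<open>Scaling an n by n matrix by \<open>c\<close> multiplies its determinant by
  \<open>c ^ n\<close>, so such a root is the phase that normalises a determinant.\<close>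

lemma unit_complex_root:
  assumes "cmod z = 1" "n > 0"
  obtains c where "cmod c = 1" "c ^ n = z"
proof -
  obtain t where "z = cis t" using unit_complex_cis[OF assms(1)] .
  then have "cis (t / n) ^ n = z" using assms(2) by (simp add: DeMoivre)
  then show ?thesis using that[of "cis (t / n)"] by simp
qed

lemma prod_cis: "finite A \<Longrightarrow> (\<Prod>i\<in>A. cis (f i)) = cis (\<Sum>i\<in>A. f i)"
  by (induction A rule: finite_induct) (auto simp: cis_mult)

lemma unitary_cis [simp]: "unitary_mat n (mat_diag n (\<lambda>i. cis (f i)))"
  by (rule unitary_mat_diag) simp

lemma det_unitary_conj:
  assumes "unitary_mat n U" "A \<in> carrier_mat n n"
  shows "det (U * A * mat_adjoint U) = det A"
proof -
  have "det U * det (mat_adjoint U) = 1"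
    using unitary_right[OF assms(1)] unitary_carrier[OF assms(1)] by (simp flip: det_mult[of _ n])
  then show ?thesis
    using assms unitary_carrier[OF assms(1)]
    by (simp add: det_mult[of _ n] mult_carrier_mat[of _ n n _ n] algebra_simps)
qed

text \<open>Determinant 1 only makes the eigenvalue angles add up to a multiple of
  \<open>2 * pi\<close>; moving one angle by that multiple makes the sum exactly 0. The angles are
  written as \<open>2 * \<phi> i\<close> because a square root of \<open>V\<close> with determinant
  1 is wanted later.\<close>

lemma SU_diagonalise:
  assumes V: "V \<in> SU n" and n: "n > 0"
  obtains U \<phi> where "U \<in> SU n" "(\<Sum>i<n. \<phi> i) = 0"
    "V = U * mat_diag n (\<lambda>i. cis (2 * \<phi> i)) * mat_adjoint U"
proof -
  note [simp] = assoc_mult_mat[of _ n n _ n _ n] mult_carrier_mat[of _ n n _ n]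
    adjoint_mult[of _ n n _ n]
  from V have uV: "unitary_mat n V" and dV: "det V = 1" by (auto simp: SU_iff)
  obtain U0 d where U0: "unitary_mat n U0" "V = U0 * mat_diag n d * mat_adjoint U0"
    using spectral_theorem_normal[of V n] unitary_left[OF uV] unitary_right[OF uV] unitary_carrier[OF uV]
    by auto
  note U0c = unitary_carrier[OF U0(1)]
  have D: "unitary_mat n (mat_diag n d)"
  proof -
    have "mat_diag n d = mat_adjoint U0 * (V * U0)"
      using U0c unitary_left[OF U0(1)] U0(1) by (simp add: U0(2) unitary_left_cancel)
    then show ?thesis
      using uV U0(1) by (simp add: unitary_mult unitary_adjoint)
  qed
  have "\<exists>t. d i = cis t" if "i < n" for i
  proof -
    have "cnj (d i) * d i = 1"
      using arg_cong[OF unitary_left[OF D], of "\<lambda>M. M $$ (i, i)"] that by simp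
    then have "(cmod (d i))\<^sup>2 = 1"
      by (metis complex_norm_square mult.commute of_real_eq_1_iff)
    then have "cmod (d i) = 1"
      by (simp add: power2_eq_1_iff) (metis norm_ge_zero neg_0_le_iff_le not_one_le_zero)
    then show ?thesis by (metis unit_complex_cis)
  qed
  then obtain \<alpha> where \<alpha>: "\<And>i. i < n \<Longrightarrow> d i = cis (\<alpha> i)" by metis
  have "(\<Prod>i<n. cis (\<alpha> i)) = 1"
    using dV det_unitary_conj[OF U0(1), of "mat_diag n d"] \<alpha> by (simp add: U0(2) det_mat_diag)
  then have "cis (\<Sum>i<n. \<alpha> i) = 1" by (simp add: prod_cis)
  then have "cos (\<Sum>i<n. \<alpha> i) = 1" by (metis cis.sel(1) one_complex.sel(1))
  then obtain m :: int where m: "(\<Sum>i<n. \<alpha> i) = m * 2 * pi" by (auto simp: cos_one_2pi_int)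
  \<comment> \<open>The whole excess is charged to index 0, which exists because
    \<open>n > 0\<close>.\<close>
  define \<phi> where "\<phi> = (\<lambda>i. (if i = 0 then \<alpha> i - m * 2 * pi else \<alpha> i) / 2)"
  have "2 * \<phi> i = \<alpha> i - (if i = 0 then m * 2 * pi else 0)" for i
    by (simp add: \<phi>_def)
  then have "2 * (\<Sum>i<n. \<phi> i) = (\<Sum>i<n. \<alpha> i) - (\<Sum>i<n. if i = 0 then m * 2 * pi else 0)"
    by (simp only: sum_distrib_left sum_subtractf)
  also have "\<dots> = 0" using n m by simp
  finally have sum0: "(\<Sum>i<n. \<phi> i) = 0" by simp
  have cis_m: "cis (of_int m * 2 * pi) = 1"
    using cis_multiple_2pi[of "of_int m"] by (simp add: mult_ac)
  have cis: "cis (2 * \<phi> i) = d i" if "i < n" for i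
    using \<alpha>[OF that] cis_m cis_divide[of "\<alpha> i" "of_int m * 2 * pi"] by (simp add: \<phi>_def)
  \<comment> \<open>A scalar phase cancels in the conjugation, so it can be used to give the
    eigenbasis determinant 1.\<close>
  obtain c where c: "cmod c = 1" "c ^ n = cnj (det U0)"
    using unit_complex_root[of "cnj (det U0)" n] cmod_det_unitary[OF U0(1)] n by auto
  define U where "U = c \<cdot>\<^sub>m U0"
  have "det U = 1"
  proof -
    have "cnj (det U0) * det U0 = 1"
      using cmod_det_unitary[OF U0(1)] by (metis complex_norm_square mult.commute of_real_1 power_one)
    then show ?thesis using U0c c by (simp add: U_def)
  qed
  then have U: "U \<in> SU n"
    using U0(1) c(1) by (simp add: SU_iff U_def unitary_smult)
  have "cnj c * c = 1" using c(1) by (metis complex_norm_square mult.commute of_real_1 power_one)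
  then have "U * mat_diag n d * mat_adjoint U = U0 * mat_diag n d * mat_adjoint U0"
    using U0c unfolding U_def adjoint_smult
    by (simp add: mult_smult_distrib[of _ n n _ n] mult_smult_assoc_mat[of _ n n _ n])
      (auto intro!: eq_matI simp flip: mult.assoc)
  then have "V = U * mat_diag n (\<lambda>i. cis (2 * \<phi> i)) * mat_adjoint U"
    using cis by (simp add: U0(2) cong: mat_diag_cong)
  then show ?thesis using that U sum0 by blast
qed

lemma SU_mult: "A \<in> SU n \<Longrightarrow> B \<in> SU n \<Longrightarrow> A * B \<in> SU n"
  by (auto simp: SU_iff unitary_mult det_mult[of _ n] unitary_carrier)

lemma SU_adjoint: "A \<in> SU n \<Longrightarrow> mat_adjoint A \<in> SU n"
  by (auto simp: SU_iff unitary_adjoint det_adjoint[of _ n] unitary_carrier)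

text \<open>The exponential of \<open>\<i> * t\<close> times \<open>pauli_Z\<close>: as last tensor
  factor it gives the two blocks opposite phases.\<close>

definition cis_pair :: "real \<Rightarrow> complex mat" where
  "cis_pair t = mat_diag 2 (\<lambda>i. if i = 0 then cis t else cis (- t))"

lemma cis_pair_SU: "cis_pair t \<in> SU 2"
  by (auto simp: SU_iff cis_pair_def det_mat_diag numeral_2_eq_2 cis_mult intro!: unitary_mat_diag)

text \<open>After opposite phases are moved into \<open>L\<close>, both blocks are special unitary,
  and the quotient of the first by the second is diagonalised as a square. Taking the two square
  roots with opposite signs of the exponent recovers both blocks from common outer factors. The
  basis \<open>W\<close> is arbitrary, so that it can later be the one belonging to
  \<open>barH n\<close>.\<close>

lemma block_diagonal_factorisation:
  assumes A: "unitary_mat N A" and B: "unitary_mat N B" and det: "det A * det B = 1"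
    and N: "N > 0" and W: "unitary_mat N W"
  obtains K0 K1 L \<phi> where "K0 \<in> SU N" "K1 \<in> SU N" "L \<in> SU 2" "(\<Sum>i<N. \<phi> i) = 0"
    "bdiag N A B = (K0 \<otimes>\<^sub>K Id2) *
       bdiag N (W * mat_diag N (\<lambda>i. cis (\<phi> i)) * mat_adjoint W) (W * mat_diag N (\<lambda>i. cis (- \<phi> i)) * mat_adjoint W) *
       (K1 \<otimes>\<^sub>K Id2) * (1\<^sub>m N \<otimes>\<^sub>K L)"
proof -
  note [simp] = assoc_mult_mat[of _ N N _ N _ N] mult_carrier_mat[of _ N N _ N]
    adjoint_mult[of _ N N _ N]
  note Ac = unitary_carrier[OF A] and Bc = unitary_carrier[OF B] and Wc = unitary_carrier[OF W]
  obtain \<theta> where \<theta>: "det A = cis \<theta>" using unit_complex_cis[OF cmod_det_unitary[OF A]] .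
  have \<theta>': "det B = cis (- \<theta>)"
    using det \<theta> by (metis cis_inverse inverse_unique)
  \<comment> \<open>Divided by \<open>N\<close> because a scalar phase enters the determinant to the
    power \<open>N\<close>.\<close>
  define t where "t = \<theta> / N"
  define A' where "A' = cis (- t) \<cdot>\<^sub>m A"
  define B' where "B' = cis t \<cdot>\<^sub>m B"
  have A': "A' \<in> SU N"
    using A Ac N \<theta> by (auto simp: A'_def SU_iff unitary_smult DeMoivre t_def cis_mult)
  have B': "B' \<in> SU N"
    using B Bc N \<theta>' by (auto simp: B'_def SU_iff unitary_smult DeMoivre t_def cis_mult)
  have A'c: "A' \<in> carrier_mat N N" and B'c: "B' \<in> carrier_mat N N" and B'u: "unitary_mat N B'"
    using A' B' by (auto simp: SU_iff unitary_carrier)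
  obtain U \<phi> where U: "U \<in> SU N" "(\<Sum>i<N. \<phi> i) = 0"
    "A' * mat_adjoint B' = U * mat_diag N (\<lambda>i. cis (2 * \<phi> i)) * mat_adjoint U"
    using SU_diagonalise[OF SU_mult[OF A' SU_adjoint[OF B']] N] .
  have Uu: "unitary_mat N U" and Ud: "det U = 1" and Uc: "U \<in> carrier_mat N N"
    using U(1) by (auto simp: SU_iff unitary_carrier)
  \<comment> \<open>As a one-parameter group, \<open>E\<close> reduces the matrix identities below
    to adding exponents: 1 + 1 = 2 for the first block and -1 + 1 = 0 for the second.\<close>
  define E where "E = (\<lambda>x :: real. mat_diag N (\<lambda>i. cis (x * \<phi> i)))"
  have Ec: "E x \<in> carrier_mat N N" for x by (simp add: E_def)
  have E_dim [simp]: "dim_row (E x) = N" for x by (simp add: E_def)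
  have E_mult: "E x * E y = E (x + y)" for x y
    by (simp add: E_def cis_mult distrib_right)
  have E_mult': "E x * (E y * M) = E (x + y) * M" if "M \<in> carrier_mat N N" for x y M
    using assoc_mult_mat[OF Ec Ec that] E_mult by simp
  have E0: "E 0 = 1\<^sub>m N" by (simp add: E_def)
  have detE: "det (E x) = 1" for x
    using U(2) by (simp add: E_def det_mat_diag prod_cis flip: sum_distrib_left)
  \<comment> \<open>The phase \<open>c\<close> gives \<open>K0\<close> determinant \<open>1\<close>; \<open>K0 W\<close> still diagonalises \<open>A' B'*\<close>, to \<open>E 2 = (E 1)\<^sup>2\<close>.\<close>
  obtain c where c: "cmod c = 1" "c ^ N = det W"
    using unit_complex_root[OF cmod_det_unitary[OF W] N] .
  have cc: "cnj c * c = 1" using c(1) by (metis complex_norm_square mult.commute of_real_1 power_one)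
  define K0 where "K0 = c \<cdot>\<^sub>m (U * mat_adjoint W)"
  have K0: "K0 \<in> SU N"
  proof -
    have "c ^ N * cnj (det W) = 1"
      unfolding c(2) using cmod_det_unitary[OF W] by (metis complex_norm_square of_real_1 power_one)
    then show ?thesis
      using Uc Wc Ud c(1) unitary_mult[OF Uu unitary_adjoint[OF W]]
      by (auto simp: K0_def SU_iff unitary_smult det_mult[of _ N] det_adjoint)
  qed
  have K0c: "K0 \<in> carrier_mat N N" and K0u: "unitary_mat N K0"
    using K0 by (auto simp: SU_iff unitary_carrier)
  have conj_K0: "K0 * (W * (E 2 * (mat_adjoint W * mat_adjoint K0))) = A' * mat_adjoint B'"
  proof -
    have "K0 * (W * (E 2 * (mat_adjoint W * mat_adjoint K0))) =
      U * (mat_adjoint W * (W * (E 2 * (mat_adjoint W * (W * mat_adjoint U)))))"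
      using Uc Wc Ec[of 2] cc unfolding K0_def adjoint_smult
      by (simp add: mult_smult_distrib[of _ N N _ N] mult_smult_assoc_mat[of _ N N _ N])
        (auto intro!: eq_matI simp flip: mult.assoc)
    also have "\<dots> = A' * mat_adjoint B'"
      using U(3) Uc Wc Ec[of 2] W by (simp add: unitary_left_cancel E_def)
    finally show ?thesis .
  qed
  \<comment> \<open>Solved from the equation for the second block, \<open>KB\<close>; the first
    block then holds \<open>E 1\<close> twice, which \<open>conj_K0\<close> turns into
    \<open>A'\<close>.\<close>
  define K1 where "K1 = W * (E 1 * (mat_adjoint W * (mat_adjoint K0 * B')))"
  have K1: "K1 \<in> SU N"
  proof -
    have "det W * det (mat_adjoint W) = 1"
      using unitary_right[OF W] Wc by (simp flip: det_mult[of _ N])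
    moreover have "det K0 = 1" "det B' = 1" using K0 B' by (auto simp: SU_iff)
    ultimately have "det K1 = 1"
      using Wc Ec[of 1] K0c B'c detE by (simp add: K1_def det_mult[of _ N] det_adjoint)
    moreover have "unitary_mat N K1"
      unfolding K1_def using W K0u B'u
      by (intro unitary_mult unitary_adjoint) (auto simp: E_def)
    ultimately show ?thesis by (simp add: SU_iff)
  qed
  have K1c: "K1 \<in> carrier_mat N N" using K1 by (auto simp: SU_iff unitary_carrier)
  have KA: "K0 * (W * E 1 * mat_adjoint W) * K1 = A'"
  proof -
    have "K0 * (W * E 1 * mat_adjoint W) * K1 = K0 * (W * (E 2 * (mat_adjoint W * mat_adjoint K0))) * B'"
      using Wc Ec K0c B'c W by (simp add: K1_def unitary_left_cancel E_mult')
    also have "\<dots> = A'"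
      unfolding conj_K0 using A'c B'c unitary_left[OF B'u] by simp
    finally show ?thesis .
  qed
  have KB: "K0 * (W * E (-1) * mat_adjoint W) * K1 = B'"
    using Wc Ec K0c B'c W K0u by (simp add: K1_def unitary_left_cancel unitary_right_cancel E_mult' E0)
  have L: "1\<^sub>m N \<otimes>\<^sub>K cis_pair t = bdiag N (cis t \<cdot>\<^sub>m 1\<^sub>m N) (cis (- t) \<cdot>\<^sub>m 1\<^sub>m N)"
  proof -
    have "0 \<cdot>\<^sub>m 1\<^sub>m N = (0\<^sub>m N N :: complex mat)" by (auto intro!: eq_matI)
    then show ?thesis by (simp add: kron_block2[of _ N] cis_pair_def)
  qed
  have "(K0 \<otimes>\<^sub>K Id2) * bdiag N (W * E 1 * mat_adjoint W) (W * E (-1) * mat_adjoint W) *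
       (K1 \<otimes>\<^sub>K Id2) * (1\<^sub>m N \<otimes>\<^sub>K cis_pair t)
    = bdiag N (A' * (cis t \<cdot>\<^sub>m 1\<^sub>m N)) (B' * (cis (- t) \<cdot>\<^sub>m 1\<^sub>m N))"
    using K0c K1c Wc Ec unfolding L KA[symmetric] KB[symmetric]
    by (simp add: kron_Id2 bdiag_mult)
  also have "A' * (cis t \<cdot>\<^sub>m 1\<^sub>m N) = A"
    using Ac by (simp add: A'_def mult_smult_distrib[of _ N N _ N])
      (auto intro!: eq_matI simp: cis_mult simp flip: mult.assoc)
  also have "B' * (cis (- t) \<cdot>\<^sub>m 1\<^sub>m N) = B"
    using Bc by (simp add: B'_def mult_smult_distrib[of _ N N _ N])
      (auto intro!: eq_matI simp: cis_mult simp flip: mult.assoc)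
  finally show ?thesis
    using that[OF K0 K1 cis_pair_SU U(2), of t] by (simp add: E_def)
qed

section \<open>The matrix exponential of a diagonalised matrix\<close>

lemma unitary_conj_diag_index:
  assumes "V \<in> carrier_mat n n" "i < n" "j < n"
  shows "(V * mat_diag n d * mat_adjoint V) $$ (i, j) = (\<Sum>l<n. V $$ (i, l) * d l * cnj (V $$ (j, l)))"
  using assms
  by (subst mult_mat_index[of _ n n _ n])
    (auto simp: mat_diag_mult_right[OF assms(1)] intro!: sum.cong)

text \<open>The inner unitary factors cancel in every power, so each entry of the series is a finite
  linear combination of scalar exponential series.\<close>

lemma mat_exp_unitary_conj_diag:
  assumes V: "unitary_mat n V"
  shows "mat_exp (V * mat_diag n d * mat_adjoint V) = V * mat_diag n (\<lambda>i. exp (d i)) * mat_adjoint V"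
proof -
  note [simp] = assoc_mult_mat[of _ n n _ n _ n] mult_carrier_mat[of _ n n _ n]
  note Vc = unitary_carrier[OF V]
  have pow: "(V * mat_diag n d * mat_adjoint V) ^\<^sub>m k = V * mat_diag n (\<lambda>i. d i ^ k) * mat_adjoint V" for k
  proof (induction k)
    case 0
    then show ?case using unitary_right[OF V] Vc by simp
  next
    case (Suc k)
    have "(V * mat_diag n d * mat_adjoint V) ^\<^sub>m Suc k =
      V * (mat_diag n (\<lambda>i. d i ^ k) * (mat_adjoint V * (V * (mat_diag n d * mat_adjoint V))))"
      using Suc Vc by simp
    also have "\<dots> = V * (mat_diag n (\<lambda>i. d i ^ k) * mat_diag n d * mat_adjoint V)"
      using Vc V by (simp add: unitary_left_cancel del: mat_diag_diag)
    also have "\<dots> = V * mat_diag n (\<lambda>i. d i ^ Suc k) * mat_adjoint V"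
      using Vc by (simp add: mult.commute)
    finally show ?case .
  qed
  have "(\<Sum>k. (V * mat_diag n (\<lambda>i. d i ^ k) * mat_adjoint V) $$ (i, j) / fact k) =
      (V * mat_diag n (\<lambda>i. exp (d i)) * mat_adjoint V) $$ (i, j)" if ij: "i < n" "j < n" for i j
  proof (rule sums_unique[symmetric])
    have "(\<lambda>k. d l ^ k / fact k) sums exp (d l)" for l
      using exp_converges[of "d l"] by (simp add: scaleR_conv_of_real divide_inverse mult.commute)
    then have "(\<lambda>k. V $$ (i, l) * (d l ^ k / fact k) * cnj (V $$ (j, l))) sums
      (V $$ (i, l) * exp (d l) * cnj (V $$ (j, l)))" for l
      by (intro sums_mult sums_mult2)
    then have "(\<lambda>k. \<Sum>l<n. V $$ (i, l) * (d l ^ k / fact k) * cnj (V $$ (j, l))) sums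
      (\<Sum>l<n. V $$ (i, l) * exp (d l) * cnj (V $$ (j, l)))"
      by (intro sums_sum)
    then show "(\<lambda>k. (V * mat_diag n (\<lambda>i. d i ^ k) * mat_adjoint V) $$ (i, j) / fact k) sums
      (V * mat_diag n (\<lambda>i. exp (d i)) * mat_adjoint V) $$ (i, j)"
      unfolding unitary_conj_diag_index[OF Vc ij] by (simp add: sum_divide_distrib)
  qed
  then show ?thesis
    using Vc unfolding mat_exp_def pow by (intro eq_matI) auto
qed

section \<open>Real spans and Kronecker products\<close>

lemma real_span_zero: "0\<^sub>m d d \<in> real_span d S"
  unfolding real_span_def by (auto intro!: exI[of _ "{}"] eq_matI)

lemma real_span_carrier: "X \<in> real_span d S \<Longrightarrow> X \<in> carrier_mat d d"
  unfolding real_span_def by auto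

lemma real_span_mono: "S \<subseteq> S' \<Longrightarrow> real_span d S \<subseteq> real_span d S'"
  unfolding real_span_def by blast

lemma real_span_smult:
  assumes "X \<in> real_span d S"
  shows "complex_of_real r \<cdot>\<^sub>m X \<in> real_span d S"
proof -
  obtain T c where T: "finite T" "T \<subseteq> S"
    "X = mat d d (\<lambda>(i, j). \<Sum>A\<in>T. complex_of_real (c A) * A $$ (i, j))"
    using assms unfolding real_span_def by blast
  have "complex_of_real r \<cdot>\<^sub>m X = mat d d (\<lambda>(i, j). \<Sum>A\<in>T. complex_of_real (r * c A) * A $$ (i, j))"
    unfolding T(3) by (rule eq_matI) (auto simp: sum_distrib_left mult.assoc)
  then show ?thesis
    using T(1,2) unfolding real_span_def
    by (intro CollectI exI[of _ T] exI[of _ "\<lambda>A. r * c A"]) simp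
qed

lemma real_span_add:
  assumes "X \<in> real_span d S" "Y \<in> real_span d S"
  shows "X + Y \<in> real_span d S"
proof -
  obtain T c where T: "finite T" "T \<subseteq> S"
    "X = mat d d (\<lambda>(i, j). \<Sum>A\<in>T. complex_of_real (c A) * A $$ (i, j))"
    using assms(1) unfolding real_span_def by blast
  obtain T' c' where T': "finite T'" "T' \<subseteq> S"
    "Y = mat d d (\<lambda>(i, j). \<Sum>A\<in>T'. complex_of_real (c' A) * A $$ (i, j))"
    using assms(2) unfolding real_span_def by blast
  \<comment> \<open>The two supports may overlap, so the coefficients are extended by 0 to the union
    before adding.\<close>
  define e where "e = (\<lambda>A. (if A \<in> T then c A else 0) + (if A \<in> T' then c' A else 0))"
  have "(\<Sum>A\<in>T \<union> T'. complex_of_real (e A) * A $$ p) =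
    (\<Sum>A\<in>T. complex_of_real (c A) * A $$ p) + (\<Sum>A\<in>T'. complex_of_real (c' A) * A $$ p)" for p
  proof -
    have "(\<Sum>A\<in>T \<union> T'. complex_of_real (e A) * A $$ p) =
      (\<Sum>A\<in>T \<union> T'. (if A \<in> T then complex_of_real (c A) * A $$ p else 0)) +
      (\<Sum>A\<in>T \<union> T'. (if A \<in> T' then complex_of_real (c' A) * A $$ p else 0))"
      unfolding sum.distrib[symmetric] e_def by (intro sum.cong) (auto simp: distrib_right)
    also have "(\<Sum>A\<in>T \<union> T'. (if A \<in> T then complex_of_real (c A) * A $$ p else 0)) =
      (\<Sum>A\<in>T. complex_of_real (c A) * A $$ p)"
      using T(1) T'(1) by (intro sum.mono_neutral_cong_right) auto
    also have "(\<Sum>A\<in>T \<union> T'. (if A \<in> T' then complex_of_real (c' A) * A $$ p else 0)) =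
      (\<Sum>A\<in>T'. complex_of_real (c' A) * A $$ p)"
      using T(1) T'(1) by (intro sum.mono_neutral_cong_right) auto
    finally show ?thesis .
  qed
  then have "X + Y = mat d d (\<lambda>(i, j). \<Sum>A\<in>T \<union> T'. complex_of_real (e A) * A $$ (i, j))"
    unfolding T(3) T'(3) by (intro eq_matI) auto
  then show ?thesis
    using T(1,2) T'(1,2) finite_UnI[of T T'] Un_least[of T S T'] unfolding real_span_def by blast
qed

lemma real_span_base:
  assumes "A \<in> S" "A \<in> carrier_mat d d"
  shows "A \<in> real_span d S"
proof -
  have "A = mat d d (\<lambda>(i, j). \<Sum>A\<in>{A}. complex_of_real 1 * A $$ (i, j))"
    using assms(2) by (intro eq_matI) auto
  then show ?thesis
    using assms(1) unfolding real_span_def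
    by (intro CollectI exI[of _ "{A}"] exI[of _ "\<lambda>_. 1"]) auto
qed

lemma real_span_induct [consumes 2, case_names zero step]:
  assumes "X \<in> real_span d S" "S \<subseteq> carrier_mat d d" "P (0\<^sub>m d d)"
    and step: "\<And>A c X. A \<in> S \<Longrightarrow> X \<in> carrier_mat d d \<Longrightarrow> P X \<Longrightarrow> P (complex_of_real c \<cdot>\<^sub>m A + X)"
  shows "P X"
proof -
  obtain T c where T: "finite T" "T \<subseteq> S"
    "X = mat d d (\<lambda>(i, j). \<Sum>A\<in>T. complex_of_real (c A) * A $$ (i, j))"
    using assms(1) unfolding real_span_def by blast
  define Z where "Z = (\<lambda>T. mat d d (\<lambda>(i, j). \<Sum>A\<in>T. complex_of_real (c A) * A $$ (i, j)))"
  have "P (Z T)"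
    using T(1,2)
  proof (induction T rule: finite_induct)
    case empty
    have "Z {} = 0\<^sub>m d d"
      unfolding Z_def by (rule eq_matI) auto
    then show ?case using assms(3) by simp
  next
    case (insert A T)
    then have A: "A \<in> carrier_mat d d" using assms(2) by auto
    have "Z (insert A T) = complex_of_real (c A) \<cdot>\<^sub>m A + Z T"
      unfolding Z_def using insert(1,2) A by (intro eq_matI) auto
    moreover have "Z T \<in> carrier_mat d d" by (simp add: Z_def)
    ultimately show ?case using insert step by simp
  qed
  then show ?thesis unfolding T(3) Z_def .
qed

lemma kron_dim [simp]:
  "dim_row (A \<otimes>\<^sub>K B) = dim_row A * dim_row B" "dim_col (A \<otimes>\<^sub>K B) = dim_col A * dim_col B"
  by (simp_all add: kron_def)

lemma kron_index:
  assumes "i < dim_row A * dim_row B" "j < dim_col A * dim_col B"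
  shows "(A \<otimes>\<^sub>K B) $$ (i, j) = A $$ (i div dim_row B, j div dim_col B) * B $$ (i mod dim_row B, j mod dim_col B)"
  using assms by (simp add: kron_def)

lemma kron_add_left:
  assumes "A \<in> carrier_mat a b" "A' \<in> carrier_mat a b"
  shows "(A + A') \<otimes>\<^sub>K B = A \<otimes>\<^sub>K B + A' \<otimes>\<^sub>K B"
  using assms by (intro eq_matI) (auto simp: kron_index less_mult_imp_div_less distrib_right)

lemma kron_smult_left: "(c \<cdot>\<^sub>m A) \<otimes>\<^sub>K B = c \<cdot>\<^sub>m (A \<otimes>\<^sub>K B)"
  by (intro eq_matI) (auto simp: kron_index less_mult_imp_div_less)

lemma kron_zero_left: "B \<in> carrier_mat c d \<Longrightarrow> 0\<^sub>m a b \<otimes>\<^sub>K B = 0\<^sub>m (a * c) (b * d)"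
  by (intro eq_matI) (auto simp: kron_index less_mult_imp_div_less)

lemma kron_one_right: "A \<otimes>\<^sub>K 1\<^sub>m 1 = A"
  by (intro eq_matI) (auto simp: kron_index)

text \<open>Both sides read off the same three mixed-radix digits of the row index and of the column
  index.\<close>

lemma kron_assoc: "(A \<otimes>\<^sub>K B) \<otimes>\<^sub>K C = A \<otimes>\<^sub>K (B \<otimes>\<^sub>K C)"
proof (rule eq_matI)
  fix i j
  assume "i < dim_row (A \<otimes>\<^sub>K (B \<otimes>\<^sub>K C))" "j < dim_col (A \<otimes>\<^sub>K (B \<otimes>\<^sub>K C))"
  then have ij: "i < dim_row A * dim_row B * dim_row C" "j < dim_col A * dim_col B * dim_col C"
    by (simp_all add: mult.assoc)
  have *: "m mod (b * c) < b * c \<and> m div c < a * b \<and> m div c div b = m div (b * c) \<and>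
    m div c mod b = m mod (b * c) div c \<and> m mod (b * c) mod c = m mod c"
    if "m < a * b * c" for a b c m :: nat
  proof -
    have pos: "b > 0" "c > 0" using that by (auto intro!: gr0I)
    have "m mod (b * c) = c * (m div c mod b) + m mod c"
      using mod_mult2_eq[of m c b] by (simp add: mult.commute)
    moreover from this have "m mod (b * c) div c = m div c mod b" using pos by simp
    moreover have "m mod (b * c) < b * c" using pos by simp
    moreover have "m div c div b = m div (b * c)" by (simp add: div_mult2_eq mult.commute[of b c])
    ultimately show ?thesis
      using that by (simp add: less_mult_imp_div_less mod_mult2_eq)
  qed
  show "((A \<otimes>\<^sub>K B) \<otimes>\<^sub>K C) $$ (i, j) = (A \<otimes>\<^sub>K (B \<otimes>\<^sub>K C)) $$ (i, j)"
    using ij *[OF ij(1)] *[OF ij(2)] by (simp add: kron_index mult.assoc)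
qed (simp_all add: mult.assoc)

text \<open>Tensoring with \<open>L\<close> is linear and maps the generators in \<open>S\<close> to
  those in \<open>kron_right S L\<close>.\<close>

lemma real_span_kron:
  assumes X: "X \<in> real_span N S" and S: "S \<subseteq> carrier_mat N N" and L: "L \<in> carrier_mat 2 2"
  shows "X \<otimes>\<^sub>K L \<in> real_span (N * 2) (kron_right S L)"
  using X S
proof (induction rule: real_span_induct)
  case zero
  show ?case unfolding kron_zero_left[OF L] by (rule real_span_zero)
next
  case (step A c X)
  have A: "A \<in> carrier_mat N N" using step S by auto
  have "A \<otimes>\<^sub>K L \<in> real_span (N * 2) (kron_right S L)"
    using step(1) A L by (intro real_span_base) (auto simp: kron_right_def)
  moreover have "(complex_of_real c \<cdot>\<^sub>m A + X) \<otimes>\<^sub>K L = complex_of_real c \<cdot>\<^sub>m (A \<otimes>\<^sub>K L) + X \<otimes>\<^sub>K L"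
    using A step(2) by (simp add: kron_add_left[of _ N N] kron_smult_left)
  ultimately show ?case
    using step(3) by (auto intro: real_span_add real_span_smult)
qed

section \<open>The torus spanned by the commuting generators\<close>

lemma barH_carrier:
  assumes n: "n \<ge> 3"
  shows "barH n \<subseteq> carrier_mat (2 ^ (n - 1)) (2 ^ (n - 1))"
proof
  fix M assume "M \<in> barH n"
  then obtain j s where j: "2 \<le> j" "j \<le> n - 1" and s: "s \<in> calH j"
    and M: "M = s \<otimes>\<^sub>K kron_pow Id2 (n - 1 - j)"
    unfolding barH_def kron_right_def by auto
  have "s \<in> carrier_mat (2 ^ j) (2 ^ j)" using calH_carrier[of j] j s by auto
  from kron_carrier[OF this kron_pow_carrier[of Id2 2 2 "n - 1 - j"]]
  show "M \<in> carrier_mat (2 ^ (n - 1)) (2 ^ (n - 1))"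
    using j by (simp add: M power_add[symmetric] del: kron_carrier)
qed

lemma barH_3: "barH 3 = calH 2"
proof -
  have "{2..3 - 1 :: nat} = {2}" by auto
  then show ?thesis by (simp add: barH_def kron_right_def kron_one_right[unfolded One_nat_def])
qed

text \<open>The recursion behind \<open>torus_exists\<close>: levels below \<open>n\<close> gain one
  identity factor, and the new level \<open>n\<close> enters with an empty Kronecker power.\<close>

lemma barH_Suc:
  assumes n: "n \<ge> 3"
  shows "barH (Suc n) = kron_right (barH n) Id2 \<union> calH n"
proof -
  have split: "{2..n} = {2..n - 1} \<union> {n}" using n by auto
  have shift: "kron_right (calH j) (kron_pow Id2 (n - j)) =
    kron_right (kron_right (calH j) (kron_pow Id2 (n - 1 - j))) Id2" if "j \<in> {2..n - 1}" for j
  proof -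
    have "n - j = Suc (n - 1 - j)" using that n unfolding atLeastAtMost_iff by linarith
    then show ?thesis by (simp add: kron_right_def image_image kron_assoc)
  qed
  have "barH (Suc n) = (\<Union>j\<in>{2..n - 1}. kron_right (calH j) (kron_pow Id2 (n - j))) \<union>
      kron_right (calH n) (1\<^sub>m 1)"
    unfolding barH_def by (simp only: diff_Suc_1 split) auto
  also have "(\<Union>j\<in>{2..n - 1}. kron_right (calH j) (kron_pow Id2 (n - j))) = kron_right (barH n) Id2"
    unfolding barH_def using shift by (auto simp: kron_right_def)
  also have "kron_right (calH n) (1\<^sub>m 1) = calH n"
    by (simp only: kron_right_def kron_one_right) simp
  finally show ?thesis .
qed

text \<open>For unitary \<open>W\<close>, these are the skew-Hermitian matrices that are diagonal in
  the basis of the columns of \<open>W\<close>.\<close>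

definition torus_mat :: "nat \<Rightarrow> complex mat \<Rightarrow> (nat \<Rightarrow> real) \<Rightarrow> complex mat" where
  "torus_mat N W \<theta> = W * mat_diag N (\<lambda>i. \<i> * complex_of_real (\<theta> i)) * mat_adjoint W"

section \<open>Hadamard conjugation and exponentials of torus elements\<close>

text \<open>The identity of size \<open>N\<close> tensored with the 2 by 2 Hadamard matrix, whose
  columns are the eigenvectors of \<open>pauli_X\<close>.\<close>

definition hadamard :: "nat \<Rightarrow> complex mat" where
  "hadamard N = (let c = complex_of_real (1 / sqrt 2) in block2 N
     (mat_diag N (\<lambda>_. c)) (mat_diag N (\<lambda>_. c)) (mat_diag N (\<lambda>_. c)) (mat_diag N (\<lambda>_. - c)))"

lemma inv_sqrt2: "complex_of_real (1 / sqrt 2) * complex_of_real (1 / sqrt 2) = 1 / 2"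
  by (simp flip: of_real_mult)

lemma unitary_hadamard: "unitary_mat (N * 2) (hadamard N)"
proof -
  have "c * c + c * c = 1" if "c = complex_of_real (1 / sqrt 2)" for c
    unfolding that inv_sqrt2 by simp
  then show ?thesis
    by (simp add: unitary_mat_def hadamard_def Let_def block2_adjoint block2_mult mat_diag_add
        mat_diag_zero bdiag_one)
qed

lemma hadamard_conj:
  "hadamard N * bdiag N (mat_diag N f) (mat_diag N g) * mat_adjoint (hadamard N) = block2 N
     (mat_diag N (\<lambda>i. (f i + g i) / 2)) (mat_diag N (\<lambda>i. (f i - g i) / 2))
     (mat_diag N (\<lambda>i. (f i - g i) / 2)) (mat_diag N (\<lambda>i. (f i + g i) / 2))"
proof -
  define c where "c = complex_of_real (1 / sqrt 2)"
  have c: "c * (x * c) = x / 2" "c * x * c = x / 2" for x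
  proof -
    have "c * x * c = (c * c) * x" by (simp only: mult_ac)
    then show "c * x * c = x / 2" using inv_sqrt2 unfolding c_def[symmetric] by simp
    then show "c * (x * c) = x / 2" by (simp only: mult.assoc)
  qed
  have "cnj c = c" by (simp add: c_def)
  then show ?thesis
    unfolding hadamard_def c_def[symmetric] Let_def
    by (simp add: block2_adjoint block2_mult block2_mult_bdiag mat_diag_add c add_divide_distrib diff_divide_distrib)
qed

lemma torus_mat_carrier [simp]: "W \<in> carrier_mat N N \<Longrightarrow> torus_mat N W \<theta> \<in> carrier_mat N N"
  by (simp add: torus_mat_def mult_carrier_mat[of _ N N _ N])

lemma torus_mat_uminus:
  assumes "W \<in> carrier_mat N N"
  shows "W * mat_diag N (\<lambda>i. - (\<i> * complex_of_real (\<theta> i))) * mat_adjoint W = - torus_mat N W \<theta>"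
  unfolding torus_mat_def
proof (rule eq_matI)
  fix i j
  assume "i < dim_row (- (W * mat_diag N (\<lambda>i. \<i> * complex_of_real (\<theta> i)) * mat_adjoint W))"
    "j < dim_col (- (W * mat_diag N (\<lambda>i. \<i> * complex_of_real (\<theta> i)) * mat_adjoint W))"
  then have ij: "i < N" "j < N" using assms by auto
  then show "(W * mat_diag N (\<lambda>i. - (\<i> * complex_of_real (\<theta> i))) * mat_adjoint W) $$ (i, j) =
    (- (W * mat_diag N (\<lambda>i. \<i> * complex_of_real (\<theta> i)) * mat_adjoint W)) $$ (i, j)"
    using assms by (subst index_uminus_mat)
      (auto simp: unitary_conj_diag_index[OF assms ij] sum_negf simp del: index_mult_mat(1))
qed (use assms in auto)

text \<open>By Euler's formulas, the half sum and half difference produced by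
  \<open>hadamard_conj\<close> are the cosine and \<open>\<i>\<close> times the sine.\<close>

lemma cs_mat_hadamard:
  "cs_mat N \<theta> = hadamard N * bdiag N (mat_diag N (\<lambda>i. cis (\<theta> i))) (mat_diag N (\<lambda>i. cis (- \<theta> i))) *
     mat_adjoint (hadamard N)"
proof -
  have "(cis t + cis (- t)) / 2 = complex_of_real (cos t)"
    "(cis t - cis (- t)) / 2 = \<i> * complex_of_real (sin t)" for t
    by (simp_all add: complex_eq_iff)
  then show ?thesis unfolding hadamard_conj cs_mat_def by simp
qed

text \<open>The eigenvalues come in pairs \<open>cis (\<theta> i)\<close> and
  \<open>cis (- \<theta> i)\<close>.\<close>

lemma det_cs_mat: "det (cs_mat N \<theta>) = 1"
  unfolding cs_mat_hadamard
  by (subst det_unitary_conj[OF unitary_hadamard])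
    (simp_all add: bdiag_mat_diag det_mat_diag prod_even_odd cis_mult flip: prod.distrib)

text \<open>The basis \<open>W\<close> on the first factors and the Hadamard basis on the last one
  diagonalise the exponent, with eigenvalues \<open>\<i>\<close> times plus and minus
  \<open>\<theta> i\<close>. This identifies the middle factor of the cosine-sine decomposition as
  an exponential, up to conjugation.\<close>

lemma mat_exp_torus_X:
  assumes W: "unitary_mat N W"
  shows "mat_exp (torus_mat N W \<theta> \<otimes>\<^sub>K pauli_X) = bdiag N W W * cs_mat N \<theta> * mat_adjoint (bdiag N W W)"
proof -
  let ?M = "N * 2"
  note [simp] = assoc_mult_mat[of _ ?M ?M _ ?M _ ?M] mult_carrier_mat[of _ ?M ?M _ ?M]
    adjoint_mult[of _ ?M ?M _ ?M]
  note Wc = unitary_carrier[OF W] and Hc = unitary_carrier[OF unitary_hadamard[of N]]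
  define d where "d = (\<lambda>i. if even i then \<i> * complex_of_real (\<theta> (i div 2)) else - (\<i> * complex_of_real (\<theta> (i div 2))))"
  define V where "V = bdiag N W W * hadamard N"
  have V: "unitary_mat ?M V"
    unfolding V_def by (intro unitary_mult unitary_bdiag W unitary_hadamard)
  have D: "mat_diag ?M d = bdiag N (mat_diag N (\<lambda>i. \<i> * complex_of_real (\<theta> i)))
      (mat_diag N (\<lambda>i. - (\<i> * complex_of_real (\<theta> i))))"
    unfolding bdiag_mat_diag d_def ..
  have "torus_mat N W \<theta> \<otimes>\<^sub>K pauli_X = bdiag N W W * (hadamard N * mat_diag ?M d * mat_adjoint (hadamard N)) *
      mat_adjoint (bdiag N W W)"
    using Wc unfolding D hadamard_conj
    by (simp add: bdiag_adjoint bdiag_mult_block2 block2_mult_bdiag kron_X[of _ N] mat_diag_zero torus_mat_def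
        mult_carrier_mat[of _ N N _ N])
  also have "\<dots> = V * mat_diag ?M d * mat_adjoint V"
    using Hc by (simp add: V_def)
  finally have "mat_exp (torus_mat N W \<theta> \<otimes>\<^sub>K pauli_X) = V * mat_diag ?M (\<lambda>i. exp (d i)) * mat_adjoint V"
    using mat_exp_unitary_conj_diag[OF V] by simp
  also have "mat_diag ?M (\<lambda>i. exp (d i)) = bdiag N (mat_diag N (\<lambda>i. cis (\<theta> i))) (mat_diag N (\<lambda>i. cis (- \<theta> i)))"
    unfolding bdiag_mat_diag d_def by (intro mat_diag_cong) (simp add: cis_conv_exp)
  also have "V * \<dots> * mat_adjoint V = bdiag N W W * cs_mat N \<theta> * mat_adjoint (bdiag N W W)"
    using Hc by (simp add: V_def cs_mat_hadamard)
  finally show ?thesis .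
qed

text \<open>Since \<open>pauli_Z\<close> is already diagonal, \<open>bdiag N W W\<close>
  diagonalises the exponent. The right side is the middle factor in
  \<open>block_diagonal_factorisation\<close>.\<close>

lemma mat_exp_torus_Z:
  assumes W: "unitary_mat N W"
  shows "mat_exp (torus_mat N W \<theta> \<otimes>\<^sub>K pauli_Z) =
    bdiag N (W * mat_diag N (\<lambda>i. cis (\<theta> i)) * mat_adjoint W) (W * mat_diag N (\<lambda>i. cis (- \<theta> i)) * mat_adjoint W)"
proof -
  let ?M = "N * 2"
  note Wc = unitary_carrier[OF W]
  define d where "d = (\<lambda>i. if even i then \<i> * complex_of_real (\<theta> (i div 2)) else - (\<i> * complex_of_real (\<theta> (i div 2))))"
  define V where "V = bdiag N W W"
  have V: "unitary_mat ?M V"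
    unfolding V_def by (intro unitary_bdiag W)
  have D: "mat_diag ?M d = bdiag N (mat_diag N (\<lambda>i. \<i> * complex_of_real (\<theta> i)))
      (mat_diag N (\<lambda>i. - (\<i> * complex_of_real (\<theta> i))))"
    unfolding bdiag_mat_diag d_def ..
  have "torus_mat N W \<theta> \<otimes>\<^sub>K pauli_Z = V * mat_diag ?M d * mat_adjoint V"
    using Wc unfolding D V_def
    by (simp add: bdiag_adjoint bdiag_mult kron_Z[of _ N] torus_mat_uminus mult_carrier_mat[of _ N N _ N])
      (simp add: torus_mat_def)
  then have "mat_exp (torus_mat N W \<theta> \<otimes>\<^sub>K pauli_Z) = V * mat_diag ?M (\<lambda>i. exp (d i)) * mat_adjoint V"
    using mat_exp_unitary_conj_diag[OF V] by simp
  also have "mat_diag ?M (\<lambda>i. exp (d i)) = bdiag N (mat_diag N (\<lambda>i. cis (\<theta> i))) (mat_diag N (\<lambda>i. cis (- \<theta> i)))"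
    unfolding bdiag_mat_diag d_def by (intro mat_diag_cong) (simp add: cis_conv_exp)
  also have "V * \<dots> * mat_adjoint V =
    bdiag N (W * mat_diag N (\<lambda>i. cis (\<theta> i)) * mat_adjoint W) (W * mat_diag N (\<lambda>i. cis (- \<theta> i)) * mat_adjoint W)"
    using Wc by (simp add: V_def bdiag_adjoint bdiag_mult mult_carrier_mat[of _ N N _ N])
  finally show ?thesis .
qed

text \<open>The scalar part is supplied by the extra generator of \<open>calH n\<close>. The
  coefficient \<open>2 * a\<close> below undoes the factor 1/2 in that generator.\<close>

lemma scalar_plus_barH_kron_X:
  assumes n: "n \<ge> 3" and b: "b \<in> real_span (2 ^ (n - 1)) (barH n)"
  shows "((\<i> * complex_of_real a) \<cdot>\<^sub>m 1\<^sub>m (2 ^ (n - 1)) + b) \<otimes>\<^sub>K pauli_X \<in> real_span (2 ^ n) (calH n)"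
proof -
  let ?N = "2 ^ (n - 1) :: nat"
  have N2: "?N * 2 = 2 ^ n" using n by (cases n) auto
  define g where "g = (\<i> / 2) \<cdot>\<^sub>m (1\<^sub>m ?N \<otimes>\<^sub>K pauli_X)"
  have "g \<in> calH n" by (simp add: g_def calH_rec[OF n] kron_pow_Id2)
  moreover have "g \<in> carrier_mat (2 ^ n) (2 ^ n)"
    using kron_carrier[of "1\<^sub>m ?N" ?N ?N pauli_X 2 2] unfolding N2 by (simp add: g_def)
  ultimately have 1: "complex_of_real (2 * a) \<cdot>\<^sub>m g \<in> real_span (2 ^ n) (calH n)"
    by (intro real_span_smult real_span_base)
  have "b \<otimes>\<^sub>K pauli_X \<in> real_span (2 ^ n) (kron_right (barH n) pauli_X)"
    using real_span_kron[OF b barH_carrier[OF n] pauli_carrier(1)] unfolding N2 .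
  then have 2: "b \<otimes>\<^sub>K pauli_X \<in> real_span (2 ^ n) (calH n)"
    using real_span_mono[of "kron_right (barH n) pauli_X" "calH n"] by (auto simp: calH_rec[OF n])
  have "((\<i> * complex_of_real a) \<cdot>\<^sub>m 1\<^sub>m ?N + b) \<otimes>\<^sub>K pauli_X = complex_of_real (2 * a) \<cdot>\<^sub>m g + b \<otimes>\<^sub>K pauli_X"
    using real_span_carrier[OF b]
    by (simp add: kron_add_left[of _ ?N ?N] kron_smult_left g_def) (auto intro!: eq_matI)
  then show ?thesis using real_span_add[OF 1 2] by simp
qed

section \<open>The Bell basis and the torus for n = 3\<close>

definition mat4 :: "complex list list \<Rightarrow> complex mat" where
  "mat4 rs = mat 4 4 (\<lambda>(i, j). rs ! i ! j)"

lemma mat4_carrier [simp]: "mat4 rs \<in> carrier_mat 4 4"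
  by (simp add: mat4_def)

lemma pauli_mat:
  "pauli_X = mat 2 2 (\<lambda>(i, j). [[0, 1], [1, 0]] ! i ! j)"
  "pauli_Y = mat 2 2 (\<lambda>(i, j). [[0, - \<i>], [\<i>, 0]] ! i ! j)"
  "pauli_Z = mat 2 2 (\<lambda>(i, j). [[1, 0], [0, - 1]] ! i ! j)"
  by (simp_all add: pauli_X_def pauli_Y_def pauli_Z_def mat_of_rows_list_def numeral_2_eq_2)

lemma less_4_cases: "i < 4 \<Longrightarrow> i = 0 \<or> i = 1 \<or> i = 2 \<or> i = (3 :: nat)"
  by auto

lemma pauli_pairs:
  "pauli_X \<otimes>\<^sub>K pauli_X = mat4 [[0, 0, 0, 1], [0, 0, 1, 0], [0, 1, 0, 0], [1, 0, 0, 0]]"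
  "pauli_Y \<otimes>\<^sub>K pauli_Y = mat4 [[0, 0, 0, - 1], [0, 0, 1, 0], [0, 1, 0, 0], [- 1, 0, 0, 0]]"
  "pauli_Z \<otimes>\<^sub>K pauli_Z = mat4 [[1, 0, 0, 0], [0, - 1, 0, 0], [0, 0, - 1, 0], [0, 0, 0, 1]]"
  unfolding pauli_mat
  by (rule eq_matI; auto simp: mat4_def kron_index dest!: less_4_cases)+

text \<open>The Bell basis, whose vectors are common eigenvectors of \<open>X \<otimes> X\<close>, \<open>Y \<otimes> Y\<close> and \<open>Z \<otimes> Z\<close>.\<close>

definition bell :: "complex mat" where
  "bell = complex_of_real (1 / sqrt 2) \<cdot>\<^sub>m
     mat4 [[1, 1, 0, 0], [0, 0, 1, 1], [0, 0, 1, - 1], [1, - 1, 0, 0]]"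

lemma bell_carrier [simp]: "bell \<in> carrier_mat 4 4"
  by (simp add: bell_def)

lemma sum_lessThan_4: "(\<Sum>i<4. f i) = f 0 + f 1 + f 2 + f (3 :: nat)" for f :: "nat \<Rightarrow> 'a :: comm_monoid_add"
  by (simp add: eval_nat_numeral)

lemma unitary_bell: "unitary_mat 4 bell"
proof -
  have entry: "(mat_adjoint bell * bell) $$ (i, j) = 1\<^sub>m 4 $$ (i, j)" if "i < 4" "j < 4" for i j
  proof -
    define c where "c = complex_of_real (1 / sqrt 2)"
    have c: "cnj c = c" "c * c = 1 / 2" using inv_sqrt2 by (simp_all add: c_def)
    show ?thesis
      using less_4_cases[OF that(1)] less_4_cases[OF that(2)]
      unfolding gram_index[OF bell_carrier that] sum_lessThan_4
      unfolding bell_def c_def[symmetric] mat4_def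
      by (elim disjE) (simp_all add: c)
  qed
  have "mat_adjoint bell * bell = 1\<^sub>m 4"
    by (rule eq_matI) (use entry carrier_matD[OF bell_carrier] in \<open>simp_all del: index_mult_mat(1)\<close>)
  then show ?thesis by (simp add: unitary_mat_def)
qed

text \<open>Four angles are exchanged for their mean and three coefficients, because the identity
  and the three Pauli pairs span the matrices that are diagonal in the Bell basis.\<close>

lemma torus_mat_bell:
  obtains b where "b \<in> real_span 4 (calH 2)"
    "torus_mat 4 bell \<theta> = (\<i> * complex_of_real ((\<Sum>i<4. \<theta> i) / 4)) \<cdot>\<^sub>m 1\<^sub>m 4 + b"
proof
  define c where "c = complex_of_real (1 / sqrt 2)"
  have c: "cnj c = c" "c * c = 1 / 2" using inv_sqrt2 by (simp_all add: c_def)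
  have cc: "c * x * c = x / 2" "c * (x * c) = x / 2" for x
  proof -
    have "c * x * c = (c * c) * x" by (simp only: mult_ac)
    then show "c * x * c = x / 2" using c(2) by simp
    then show "c * (x * c) = x / 2" by (simp only: mult.assoc)
  qed
  \<comment> \<open>The signs are the eigenvalues of the Pauli pairs on the four Bell vectors.
    Averaging divides by 4, and the factor 1/2 in the generators turns this into 2.\<close>
  let ?x = "(\<theta> 0 - \<theta> 1 + \<theta> 2 - \<theta> 3) / 2" and ?y = "(- \<theta> 0 + \<theta> 1 + \<theta> 2 - \<theta> 3) / 2"
    and ?z = "(\<theta> 0 + \<theta> 1 - \<theta> 2 - \<theta> 3) / 2"
  let ?X = "(\<i> / 2) \<cdot>\<^sub>m (pauli_X \<otimes>\<^sub>K pauli_X)" and ?Y = "(\<i> / 2) \<cdot>\<^sub>m (pauli_Y \<otimes>\<^sub>K pauli_Y)"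
    and ?Z = "(\<i> / 2) \<cdot>\<^sub>m (pauli_Z \<otimes>\<^sub>K pauli_Z)"
  let ?b = "complex_of_real ?x \<cdot>\<^sub>m ?X + (complex_of_real ?y \<cdot>\<^sub>m ?Y + complex_of_real ?z \<cdot>\<^sub>m ?Z)"
  have carr: "M \<in> carrier_mat 4 4" if "M \<in> calH 2" for M
    using calH_carrier[of 2] that by auto
  show "?b \<in> real_span 4 (calH 2)"
    by (intro real_span_add real_span_smult real_span_base carr) (auto simp: calH_2)
  have entry: "torus_mat 4 bell \<theta> $$ (i, j) = ((\<i> * complex_of_real ((\<Sum>i<4. \<theta> i) / 4)) \<cdot>\<^sub>m 1\<^sub>m 4 + ?b) $$ (i, j)"
    if "i < 4" "j < 4" for i j
  proof -
    show ?thesis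
      using less_4_cases[OF that(1)] less_4_cases[OF that(2)]
      unfolding torus_mat_def unitary_conj_diag_index[OF bell_carrier that] sum_lessThan_4 pauli_pairs
      unfolding bell_def c_def[symmetric] mat4_def
      by (elim disjE) (simp_all add: c cc complex_eq_iff add_divide_distrib diff_divide_distrib)
  qed
  show "torus_mat 4 bell \<theta> = (\<i> * complex_of_real ((\<Sum>i<4. \<theta> i) / 4)) \<cdot>\<^sub>m 1\<^sub>m 4 + ?b"
  proof (rule eq_matI)
    have "?b \<in> carrier_mat 4 4" by (simp add: pauli_pairs mat4_def)
    then have dims: "dim_row ((\<i> * complex_of_real ((\<Sum>i<4. \<theta> i) / 4)) \<cdot>\<^sub>m 1\<^sub>m 4 + ?b) = 4"
      "dim_col ((\<i> * complex_of_real ((\<Sum>i<4. \<theta> i) / 4)) \<cdot>\<^sub>m 1\<^sub>m 4 + ?b) = 4" by auto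
    show "torus_mat 4 bell \<theta> $$ (i, j) = ((\<i> * complex_of_real ((\<Sum>i<4. \<theta> i) / 4)) \<cdot>\<^sub>m 1\<^sub>m 4 + ?b) $$ (i, j)"
      if "i < dim_row ((\<i> * complex_of_real ((\<Sum>i<4. \<theta> i) / 4)) \<cdot>\<^sub>m 1\<^sub>m 4 + ?b)"
        "j < dim_col ((\<i> * complex_of_real ((\<Sum>i<4. \<theta> i) / 4)) \<cdot>\<^sub>m 1\<^sub>m 4 + ?b)" for i j
      using that unfolding dims by (rule entry)
    show "dim_row (torus_mat 4 bell \<theta>) = dim_row ((\<i> * complex_of_real ((\<Sum>i<4. \<theta> i) / 4)) \<cdot>\<^sub>m 1\<^sub>m 4 + ?b)"
      "dim_col (torus_mat 4 bell \<theta>) = dim_col ((\<i> * complex_of_real ((\<Sum>i<4. \<theta> i) / 4)) \<cdot>\<^sub>m 1\<^sub>m 4 + ?b)"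
      unfolding dims using carrier_matD[OF torus_mat_carrier[OF bell_carrier, of \<theta>]] by auto
  qed
qed

section \<open>The induction step for the torus: one more tensor factor\<close>

text \<open>The two angles at \<open>2 * i\<close> and \<open>Suc (2 * i)\<close> belong to the
  eigenvalues 1 and -1 of \<open>pauli_X\<close> on the last factor, so their half sum multiplies
  the identity and their half difference multiplies \<open>pauli_X\<close>.\<close>

lemma torus_mat_hadamard:
  assumes W: "W \<in> carrier_mat N N"
  shows "torus_mat (N * 2) (bdiag N W W * hadamard N) \<theta> =
    torus_mat N W (\<lambda>i. (\<theta> (2 * i) + \<theta> (Suc (2 * i))) / 2) \<otimes>\<^sub>K Id2 +
    torus_mat N W (\<lambda>i. (\<theta> (2 * i) - \<theta> (Suc (2 * i))) / 2) \<otimes>\<^sub>K pauli_X"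
proof -
  let ?M = "N * 2"
  note [simp] = assoc_mult_mat[of _ ?M ?M _ ?M _ ?M] mult_carrier_mat[of _ ?M ?M _ ?M]
    adjoint_mult[of _ ?M ?M _ ?M]
  note Hc = unitary_carrier[OF unitary_hadamard[of N]]
  let ?f = "\<lambda>i. \<i> * complex_of_real (\<theta> (2 * i))" and ?g = "\<lambda>i. \<i> * complex_of_real (\<theta> (Suc (2 * i)))"
  let ?p = "\<lambda>i. (\<theta> (2 * i) + \<theta> (Suc (2 * i))) / 2" and ?m = "\<lambda>i. (\<theta> (2 * i) - \<theta> (Suc (2 * i))) / 2"
  have diag: "mat_diag ?M (\<lambda>i. \<i> * complex_of_real (\<theta> i)) = bdiag N (mat_diag N ?f) (mat_diag N ?g)"
    unfolding bdiag_mat_diag by (intro mat_diag_cong) auto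
  have half: "mat_diag N (\<lambda>i. (?f i + ?g i) / 2) = mat_diag N (\<lambda>i. \<i> * complex_of_real (?p i))"
    "mat_diag N (\<lambda>i. (?f i - ?g i) / 2) = mat_diag N (\<lambda>i. \<i> * complex_of_real (?m i))"
    by (auto intro!: mat_diag_cong simp: algebra_simps diff_divide_distrib)
  have "torus_mat ?M (bdiag N W W * hadamard N) \<theta> = bdiag N W W *
    (hadamard N * bdiag N (mat_diag N ?f) (mat_diag N ?g) * mat_adjoint (hadamard N)) * mat_adjoint (bdiag N W W)"
    unfolding torus_mat_def diag using Hc by simp
  also have "\<dots> = block2 N (torus_mat N W ?p) (torus_mat N W ?m) (torus_mat N W ?m) (torus_mat N W ?p)"
    unfolding hadamard_conj half using W
    by (simp add: bdiag_adjoint bdiag_mult_block2 block2_mult_bdiag torus_mat_def mult_carrier_mat[of _ N N _ N])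
  also have "\<dots> = torus_mat N W ?p \<otimes>\<^sub>K Id2 + torus_mat N W ?m \<otimes>\<^sub>K pauli_X"
    using W by (simp add: kron_Id2[of _ N] kron_X[of _ N] block2_add)
  finally show ?thesis .
qed

text \<open>In the induction the half sums give a scalar plus an element of the span of
  \<open>kron_right (barH n) Id2\<close>, and the half differences an element of the span of
  \<open>calH n\<close>; \<open>barH_Suc\<close> joins the two. The scalar is kept explicit because
  it must vanish for membership in \<open>frak_f n\<close>.\<close>

lemma torus_exists:
  assumes "n \<ge> 3"
  shows "\<exists>W. unitary_mat (2 ^ (n - 1)) W \<and> (\<forall>\<theta>. \<exists>b \<in> real_span (2 ^ (n - 1)) (barH n).
    torus_mat (2 ^ (n - 1)) W \<theta> =
      (\<i> * complex_of_real ((\<Sum>i<2 ^ (n - 1). \<theta> i) / 2 ^ (n - 1))) \<cdot>\<^sub>m 1\<^sub>m (2 ^ (n - 1)) + b)"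
  using assms
proof (induction n rule: nat_induct_at_least)
  case base
  have pow: "(2 :: nat) ^ (3 - 1) = 4" "(2 :: real) ^ (3 - 1) = 4" by simp_all
  have "\<exists>b \<in> real_span 4 (calH 2).
    torus_mat 4 bell \<theta> = (\<i> * complex_of_real ((\<Sum>i<4. \<theta> i) / 4)) \<cdot>\<^sub>m 1\<^sub>m 4 + b" for \<theta>
    using torus_mat_bell[of \<theta>] by blast
  then show ?case
    unfolding barH_3 pow using unitary_bell by blast
next
  case (Suc n)
  let ?N = "2 ^ (n - 1) :: nat"
  have N2: "2 ^ (Suc n - 1) = ?N * 2" using Suc.hyps by (cases n) auto
  have N2r: "(2 :: real) ^ (Suc n - 1) = 2 ^ (n - 1) * 2" using Suc.hyps by (cases n) auto
  obtain W where W: "unitary_mat ?N W" and span: "\<And>\<theta>. \<exists>b \<in> real_span ?N (barH n).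
    torus_mat ?N W \<theta> = (\<i> * complex_of_real ((\<Sum>i<?N. \<theta> i) / 2 ^ (n - 1))) \<cdot>\<^sub>m 1\<^sub>m ?N + b"
    using Suc.IH by blast
  note Wc = unitary_carrier[OF W]
  have "\<exists>b \<in> real_span (?N * 2) (barH (Suc n)). torus_mat (?N * 2) (bdiag ?N W W * hadamard ?N) \<theta> =
    (\<i> * complex_of_real ((\<Sum>i<?N * 2. \<theta> i) / (2 ^ (n - 1) * 2))) \<cdot>\<^sub>m 1\<^sub>m (?N * 2) + b" for \<theta>
  proof -
    let ?p = "\<lambda>i. (\<theta> (2 * i) + \<theta> (Suc (2 * i))) / 2" and ?m = "\<lambda>i. (\<theta> (2 * i) - \<theta> (Suc (2 * i))) / 2"
    define a where "a = (\<Sum>i<?N. ?p i) / 2 ^ (n - 1)"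
    \<comment> \<open>The mean of all angles is the mean of the half sums, so the scalar part keeps
      its form at the next level.\<close>
    have a: "(\<Sum>i<?N * 2. \<theta> i) / (2 ^ (n - 1) * 2) = a"
      by (simp add: a_def sum_even_odd sum.distrib flip: sum_divide_distrib)
    obtain b where b: "b \<in> real_span ?N (barH n)"
      "torus_mat ?N W ?p = (\<i> * complex_of_real a) \<cdot>\<^sub>m 1\<^sub>m ?N + b"
      using span[of ?p] unfolding a_def by blast
    \<comment> \<open>The scalar \<open>a'\<close> may be nonzero: after tensoring with
      \<open>pauli_X\<close> it lies in the span of \<open>calH n\<close>.\<close>
    obtain b' a' where b': "b' \<in> real_span ?N (barH n)"
      "torus_mat ?N W ?m = (\<i> * complex_of_real a') \<cdot>\<^sub>m 1\<^sub>m ?N + b'"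
      using span[of ?m] by blast
    have "2 ^ n = ?N * 2" using N2 by simp
    then have "torus_mat ?N W ?m \<otimes>\<^sub>K pauli_X \<in> real_span (?N * 2) (calH n)"
      using scalar_plus_barH_kron_X[OF Suc.hyps b'(1), of a'] unfolding b'(2) by simp
    then have X: "torus_mat ?N W ?m \<otimes>\<^sub>K pauli_X \<in> real_span (?N * 2) (barH (Suc n))"
      using real_span_mono[of "calH n" "barH (Suc n)"] barH_Suc[OF Suc.hyps] by blast
    have "b \<otimes>\<^sub>K Id2 \<in> real_span (?N * 2) (kron_right (barH n) Id2)"
      by (intro real_span_kron b barH_carrier Suc.hyps) simp
    then have I: "b \<otimes>\<^sub>K Id2 \<in> real_span (?N * 2) (barH (Suc n))"
      using real_span_mono[of "kron_right (barH n) Id2" "barH (Suc n)"] barH_Suc[OF Suc.hyps] by blast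
    have "torus_mat ?N W ?p \<otimes>\<^sub>K Id2 = (\<i> * complex_of_real a) \<cdot>\<^sub>m 1\<^sub>m (?N * 2) + b \<otimes>\<^sub>K Id2"
      using real_span_carrier[OF b(1)] kron_Id2[of "1\<^sub>m ?N" ?N] unfolding b(2) bdiag_one
      by (simp add: kron_add_left[of _ ?N ?N] kron_smult_left)
    then have "torus_mat (?N * 2) (bdiag ?N W W * hadamard ?N) \<theta> =
      (\<i> * complex_of_real a) \<cdot>\<^sub>m 1\<^sub>m (?N * 2) + (b \<otimes>\<^sub>K Id2 + torus_mat ?N W ?m \<otimes>\<^sub>K pauli_X)"
      unfolding torus_mat_hadamard[OF Wc]
      using real_span_carrier[OF I] real_span_carrier[OF X]
      by (simp add: assoc_add_mat[of _ "?N * 2" "?N * 2"])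
    then show ?thesis
      unfolding a using real_span_add[OF I X] by blast
  qed
  moreover have "unitary_mat (?N * 2) (bdiag ?N W W * hadamard ?N)"
    by (intro unitary_mult unitary_bdiag W unitary_hadamard)
  ultimately show ?case unfolding N2 N2r by blast
qed

section \<open>The Khaneja--Glaser decomposition\<close>

theorem corollary13:
  fixes n :: nat and G :: "complex mat"
  assumes "n \<ge> 3" and "G \<in> SU (2 ^ n)"
  shows "\<exists>K0 \<in> SU (2 ^ (n - 1)). \<exists>K1 \<in> SU (2 ^ (n - 1)).
         \<exists>K2 \<in> SU (2 ^ (n - 1)). \<exists>K3 \<in> SU (2 ^ (n - 1)).
         \<exists>L0 \<in> SU 2. \<exists>L1 \<in> SU 2. \<exists>h0 \<in> frak_h n. \<exists>f0 \<in> frak_f n. \<exists>f1 \<in> frak_f n.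
           G = (K0 \<otimes>\<^sub>K Id2) * mat_exp f0 * (K1 \<otimes>\<^sub>K Id2) * (kron_pow Id2 (n - 1) \<otimes>\<^sub>K L0)
             * mat_exp h0
             * (K2 \<otimes>\<^sub>K Id2) * mat_exp f1 * (K3 \<otimes>\<^sub>K Id2) * (kron_pow Id2 (n - 1) \<otimes>\<^sub>K L1)"
proof -
  define N where "N = (2 :: nat) ^ (n - 1)"
  let ?M = "N * 2"
  have N: "N > 0" by (simp add: N_def)
  have M: "2 ^ n = ?M" unfolding N_def using assms(1) by (cases n) auto
  note aM = assoc_mult_mat[of _ ?M ?M _ ?M _ ?M] and cM = mult_carrier_mat[of _ ?M ?M _ ?M]
  obtain W where W: "unitary_mat N W" and span: "\<And>\<theta>. \<exists>b \<in> real_span N (barH n).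
    torus_mat N W \<theta> = (\<i> * complex_of_real ((\<Sum>i<N. \<theta> i) / 2 ^ (n - 1))) \<cdot>\<^sub>m 1\<^sub>m N + b"
    using torus_exists[OF assms(1)] unfolding N_def by blast
  note Wc = unitary_carrier[OF W]
  have h_mem: "torus_mat N W \<theta> \<otimes>\<^sub>K pauli_X \<in> frak_h n" for \<theta>
  proof -
    obtain b where "b \<in> real_span N (barH n)"
      "torus_mat N W \<theta> = (\<i> * complex_of_real ((\<Sum>i<N. \<theta> i) / 2 ^ (n - 1))) \<cdot>\<^sub>m 1\<^sub>m N + b"
      using span[of \<theta>] by blast
    then show ?thesis
      using scalar_plus_barH_kron_X[OF assms(1)] by (simp only: frak_h_def N_def)
  qed
  \<comment> \<open>Unlike \<open>calH n\<close>, the set \<open>calF n\<close> has no separate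
    generator for the scalar part, so the mean of the angles has to be 0. This is why
    \<open>block_diagonal_factorisation\<close> provides a zero sum.\<close>
  have f_mem: "torus_mat N W \<phi> \<otimes>\<^sub>K pauli_Z \<in> frak_f n" if sum0: "(\<Sum>i<N. \<phi> i) = 0" for \<phi>
  proof -
    obtain b where b: "b \<in> real_span N (barH n)" "torus_mat N W \<phi> = 0 \<cdot>\<^sub>m 1\<^sub>m N + b"
      using span[of \<phi>] unfolding sum0 by auto
    have "torus_mat N W \<phi> = b"
      using real_span_carrier[OF b(1)] unfolding b(2) by (auto intro!: eq_matI)
    then show ?thesis
      using real_span_kron[OF b(1) _ pauli_carrier(3)] barH_carrier[OF assms(1)] M
      by (simp add: frak_f_def calF_def N_def)
  qed
  have G: "unitary_mat ?M G" "det G = 1" using assms(2) by (auto simp: SU_iff M)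
  obtain A1 A2 B1 B2 \<theta> where A: "unitary_mat N A1" "unitary_mat N A2" and B: "unitary_mat N B1" "unitary_mat N B2"
    and G_eq: "G = bdiag N A1 A2 * cs_mat N \<theta> * bdiag N B1 B2"
    using cosine_sine_decomposition[OF G(1)] .
  define E where "E = mat_exp (torus_mat N W \<theta> \<otimes>\<^sub>K pauli_X)"
  have E: "E = bdiag N W W * cs_mat N \<theta> * mat_adjoint (bdiag N W W)"
    unfolding E_def by (rule mat_exp_torus_X[OF W])
  have WW: "unitary_mat ?M (bdiag N W W)" by (intro unitary_bdiag W)
  have Ec: "E \<in> carrier_mat ?M ?M" by (simp add: E cM)
  have detE: "det E = 1"
    unfolding E by (simp add: det_unitary_conj[OF WW] det_cs_mat)
  \<comment> \<open>The conjugation by \<open>W\<close> that turns \<open>cs_mat N \<theta>\<close>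
    into \<open>E\<close> is compensated in the outer block diagonal factors.\<close>
  let ?A1 = "A1 * mat_adjoint W" and ?A2 = "A2 * mat_adjoint W"
  let ?B1 = "W * B1" and ?B2 = "W * B2"
  have A': "unitary_mat N ?A1" "unitary_mat N ?A2" and B': "unitary_mat N ?B1" "unitary_mat N ?B2"
    using A B W by (auto intro: unitary_mult unitary_adjoint)
  note carr = unitary_carrier[OF A(1)] unitary_carrier[OF A(2)] unitary_carrier[OF B(1)]
    unitary_carrier[OF B(2)] Wc
  note carr' = unitary_carrier[OF A'(1)] unitary_carrier[OF A'(2)] unitary_carrier[OF B'(1)]
    unitary_carrier[OF B'(2)]
  have "G = bdiag N ?A1 ?A2 * E * bdiag N ?B1 ?B2"
  proof -
    have "bdiag N ?A1 ?A2 = bdiag N A1 A2 * mat_adjoint (bdiag N W W)" "bdiag N ?B1 ?B2 = bdiag N W W * bdiag N B1 B2"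
      using carr by (simp_all add: bdiag_adjoint bdiag_mult)
    then show ?thesis
      using WW unfolding G_eq E
      by (simp add: aM cM unitary_left_cancel carrier_matD[OF cs_mat_carrier])
  qed
  \<comment> \<open>\<open>block_diagonal_factorisation\<close> needs blocks whose determinants
    multiply to 1. The phase \<open>c\<close> arranges this on the left, and its inverse
    \<open>cnj c\<close> goes to the right factor.\<close>
  moreover obtain c where c: "cmod c = 1" "c ^ ?M = cnj (det ?A1 * det ?A2)"
    using unit_complex_root[of "cnj (det ?A1 * det ?A2)" ?M] cmod_det_unitary[OF A'(1)] cmod_det_unitary[OF A'(2)] N
    by (auto simp: norm_mult)
  moreover have "c * cnj c = 1" using c(1) by (metis complex_norm_square of_real_1 power_one)
  ultimately have G_eq': "G = bdiag N (c \<cdot>\<^sub>m ?A1) (c \<cdot>\<^sub>m ?A2) * E * bdiag N (cnj c \<cdot>\<^sub>m ?B1) (cnj c \<cdot>\<^sub>m ?B2)"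
    using carr' Ec
    by (simp add: bdiag_smult mult_smult_distrib[of _ ?M ?M _ ?M] mult_smult_assoc_mat[of _ ?M ?M _ ?M] cM)
      (auto intro!: eq_matI simp: mult.commute simp flip: mult.assoc)
  have cA: "unitary_mat N (c \<cdot>\<^sub>m ?A1)" "unitary_mat N (c \<cdot>\<^sub>m ?A2)"
    and cB: "unitary_mat N (cnj c \<cdot>\<^sub>m ?B1)" "unitary_mat N (cnj c \<cdot>\<^sub>m ?B2)"
    using A' B' c(1) by (auto intro: unitary_smult)
  have detA: "det (c \<cdot>\<^sub>m ?A1) * det (c \<cdot>\<^sub>m ?A2) = 1"
  proof -
    have "det (c \<cdot>\<^sub>m ?A1) * det (c \<cdot>\<^sub>m ?A2) = c ^ ?M * (det ?A1 * det ?A2)"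
      using carr' carr by (simp add: power_add mult_2_right algebra_simps)
    also have "\<dots> = complex_of_real ((cmod (det ?A1 * det ?A2))\<^sup>2)"
      unfolding c(2) by (simp only: complex_norm_square mult.commute)
    also have "\<dots> = 1"
      using cmod_det_unitary[OF A'(1)] cmod_det_unitary[OF A'(2)] by (simp add: norm_mult)
    finally show ?thesis .
  qed
  \<comment> \<open>No second phase is chosen: \<open>G\<close>, \<open>E\<close> and the left
    factor have determinant 1, hence so does the right factor.\<close>
  have detB: "det (cnj c \<cdot>\<^sub>m ?B1) * det (cnj c \<cdot>\<^sub>m ?B2) = 1"
  proof -
    have "det G = det (bdiag N (c \<cdot>\<^sub>m ?A1) (c \<cdot>\<^sub>m ?A2)) * det E * det (bdiag N (cnj c \<cdot>\<^sub>m ?B1) (cnj c \<cdot>\<^sub>m ?B2))"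
      using Ec unfolding G_eq' by (simp only: det_mult[of _ ?M] cM block2_carrier)
    then show ?thesis
      unfolding G(2) detE det_bdiag[OF cA] det_bdiag[OF cB] detA by simp
  qed
  obtain K0 K1 L0 \<phi> where K: "K0 \<in> SU N" "K1 \<in> SU N" "L0 \<in> SU 2" "(\<Sum>i<N. \<phi> i) = 0"
    "bdiag N (c \<cdot>\<^sub>m ?A1) (c \<cdot>\<^sub>m ?A2) =
      (K0 \<otimes>\<^sub>K Id2) * mat_exp (torus_mat N W \<phi> \<otimes>\<^sub>K pauli_Z) * (K1 \<otimes>\<^sub>K Id2) * (1\<^sub>m N \<otimes>\<^sub>K L0)"
    using block_diagonal_factorisation[OF cA detA N W] unfolding mat_exp_torus_Z[OF W] by metis
  obtain K2 K3 L1 \<psi> where K': "K2 \<in> SU N" "K3 \<in> SU N" "L1 \<in> SU 2" "(\<Sum>i<N. \<psi> i) = 0"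
    "bdiag N (cnj c \<cdot>\<^sub>m ?B1) (cnj c \<cdot>\<^sub>m ?B2) =
      (K2 \<otimes>\<^sub>K Id2) * mat_exp (torus_mat N W \<psi> \<otimes>\<^sub>K pauli_Z) * (K3 \<otimes>\<^sub>K Id2) * (1\<^sub>m N \<otimes>\<^sub>K L1)"
    using block_diagonal_factorisation[OF cB detB N W] unfolding mat_exp_torus_Z[OF W] by metis
  have kron_c: "K \<otimes>\<^sub>K Id2 \<in> carrier_mat ?M ?M" if "K \<in> SU N" for K
    using that by (intro kron_carrier) (auto simp: SU_def)
  have kron_L: "1\<^sub>m N \<otimes>\<^sub>K L \<in> carrier_mat ?M ?M" if "L \<in> SU 2" for L
    using that by (intro kron_carrier) (auto simp: SU_def)
  have exp_c: "mat_exp (torus_mat N W \<phi> \<otimes>\<^sub>K pauli_Z) \<in> carrier_mat ?M ?M" for \<phi>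
    unfolding mat_exp_torus_Z[OF W] by simp
  have "G = (K0 \<otimes>\<^sub>K Id2) * mat_exp (torus_mat N W \<phi> \<otimes>\<^sub>K pauli_Z) * (K1 \<otimes>\<^sub>K Id2) * (kron_pow Id2 (n - 1) \<otimes>\<^sub>K L0)
    * mat_exp (torus_mat N W \<theta> \<otimes>\<^sub>K pauli_X)
    * (K2 \<otimes>\<^sub>K Id2) * mat_exp (torus_mat N W \<psi> \<otimes>\<^sub>K pauli_Z) * (K3 \<otimes>\<^sub>K Id2) * (kron_pow Id2 (n - 1) \<otimes>\<^sub>K L1)"
    unfolding G_eq' K(5) K'(5) kron_pow_Id2 N_def[symmetric] E_def[symmetric]
    using kron_c[OF K(1)] kron_c[OF K(2)] kron_c[OF K'(1)] kron_c[OF K'(2)] kron_L[OF K(3)] kron_L[OF K'(3)]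
      exp_c Ec
    by (simp add: aM cM)
  then show ?thesis
    unfolding N_def[symmetric]
    using K(1-3) K'(1-3) h_mem f_mem[OF K(4)] f_mem[OF K'(4)] by blast
qed

end
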